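(* Let $K\subset\mathbb{S}^2$ be a convex body whose boundary contains a geodesic segment. Then for all sufficiently small $\delta>0$ the illumination body $$\mathcal{I}_\delta^s(K)=\{\mathbf{x}\in\mathbb{S}^2:\mathrm{vol}_2^s([\mathbf{x},K]\setminus K)\le\delta\}$$ is not (geodesically) convex.
   Context: $\mathbb{S}^2$ is the unit sphere with its round metric of curvature $1$, and $\mathrm{vol}_2^s$ is spherical area. A convex body in $\mathbb{S}^2$ is a compact, geodesically convex set with nonempty interior; convex bodies are contained in an open hemisphere. $[\mathbf{x},K]=\mathrm{conv}(\{\mathbf{x}\}\cup K)$, where $\mathrm{conv}$ is the geodesic convex hull. A geodesic segment is a nondegenerate great-circle arc. *)

theory Defs
  imports "HOL-Analysis.Analysis"
begin

abbreviation S2 :: "(real ^ 3) set" where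
  "S2 \<equiv> sphere 0 1"

definition orthonormal_pair :: "real ^ 3 \<Rightarrow> real ^ 3 \<Rightarrow> bool" where
  "orthonormal_pair u v \<longleftrightarrow> norm u = 1 \<and> norm v = 1 \<and> u \<bullet> v = 0"

text \<open>For an orthonormal pair, this is the unit speed parametrisation of the great circle that
  starts at \<open>u\<close> in direction \<open>v\<close>.\<close>

definition great_circle :: "real ^ 3 \<Rightarrow> real ^ 3 \<Rightarrow> real \<Rightarrow> real ^ 3" where
  "great_circle u v t = cos t *\<^sub>R u + sin t *\<^sub>R v"

definition geodesic_segment :: "(real ^ 3) set \<Rightarrow> bool" where
  "geodesic_segment A \<longleftrightarrow>
    (\<exists>u v l. orthonormal_pair u v \<and> 0 < l \<and> l < 2 * pi \<and> A = great_circle u v ` {0..l})"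

text \<open>The great-circle arcs of length less than \<open>pi\<close> are exactly the unique minimal
  geodesics between non-antipodal points. No condition is imposed on antipodal pairs of points
  (which are joined by infinitely many minimal geodesics). Equivalently, the set of nonnegative
  multiples of points of the set is a convex cone.\<close>

definition geodesically_convex :: "(real ^ 3) set \<Rightarrow> bool" where
  "geodesically_convex C \<longleftrightarrow> C \<subseteq> S2 \<and>
    (\<forall>u v l. orthonormal_pair u v \<longrightarrow> 0 \<le> l \<longrightarrow> l < pi \<longrightarrow>
       great_circle u v 0 \<in> C \<longrightarrow> great_circle u v l \<in> C \<longrightarrow> great_circle u v ` {0..l} \<subseteq> C)"

text \<open>Interior and boundary are relative to the sphere; as a subset of the ambient space every
  subset of the sphere has empty interior.\<close>

definition convex_body :: "(real ^ 3) set \<Rightarrow> bool" where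
  "convex_body K \<longleftrightarrow> compact K \<and> geodesically_convex K \<and>
     top_of_set S2 interior_of K \<noteq> {} \<and> (\<exists>w\<in>S2. \<forall>x\<in>K. 0 < w \<bullet> x)"

definition sphere_boundary :: "(real ^ 3) set \<Rightarrow> (real ^ 3) set" where
  "sphere_boundary K = top_of_set S2 frontier_of K"

text \<open>The surface measure on the sphere: since Lebesgue measure in polar coordinates is
  \<open>r\<^sup>2 dr\<close> times area, the solid sector over \<open>A\<close> has one third of
  the area of \<open>A\<close> as its volume. Total mass and rotation invariance, which characterise
  this measure, are proved below.\<close>

definition sector :: "(real ^ 3) set \<Rightarrow> (real ^ 3) set" where
  "sector A = {r *\<^sub>R x | r x. 0 \<le> r \<and> r \<le> 1 \<and> x \<in> A}"

definition spherical_area :: "(real ^ 3) set \<Rightarrow> real" where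
  "spherical_area A = 3 * measure lebesgue (sector A)"

lemma spherical_area_S2: "spherical_area S2 = 4 * pi"
proof -
  have "sector S2 = cball (0 :: real ^ 3) 1"
  proof (intro set_eqI iffI)
    fix y :: "real ^ 3" assume y: "y \<in> cball 0 1"
    obtain e :: "real ^ 3" where e: "norm e = 1"
      using vector_choose_size[of 1] by auto
    show "y \<in> sector S2"
    proof (cases "y = 0")
      case True
      then show ?thesis using e by (force simp: sector_def)
    next
      case False
      then have "y = norm y *\<^sub>R (y /\<^sub>R norm y)" "norm (y /\<^sub>R norm y) = 1" by simp_all
      with y show ?thesis unfolding sector_def
        by (intro CollectI exI[of _ "norm y"] exI[of _ "y /\<^sub>R norm y"]) auto
    qed
  qed (auto simp: sector_def)
  then show ?thesis
    by (simp add: spherical_area_def content_cball unit_ball_vol_3)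
qed

lemma spherical_area_rotation:
  assumes "orthogonal_transformation f" "A \<subseteq> S2" "sector A \<in> sets lebesgue"
  shows "spherical_area (f ` A) = spherical_area A"
proof -
  have "linear f" using assms(1) by (rule orthogonal_transformation_linear)
  then have "sector (f ` A) = f ` sector A"
    unfolding sector_def by (auto simp: linear_scale image_iff) (metis linear_scale)+
  moreover have "sector A \<subseteq> cball 0 1"
    using assms(2) unfolding sector_def by auto
  then have "sector A \<in> lmeasurable"
    using assms(3) bounded_subset[OF bounded_cball] bounded_set_imp_lmeasurable by blast
  then have "measure lebesgue (f ` sector A) = measure lebesgue (sector A)"
    using assms(1) by (intro measure_orthogonal_image)
  ultimately show ?thesis by (simp add: spherical_area_def)
qed

text \<open>Here \<open>hull\<close> is the intersection of all geodesically convex supersets.\<close>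

definition geodesic_join :: "real ^ 3 \<Rightarrow> (real ^ 3) set \<Rightarrow> (real ^ 3) set" where
  "geodesic_join x K = geodesically_convex hull ({x} \<union> K)"

definition illumination_body :: "real \<Rightarrow> (real ^ 3) set \<Rightarrow> (real ^ 3) set" where
  "illumination_body \<delta> K = {x \<in> S2. spherical_area (geodesic_join x K - K) \<le> \<delta>}"

end

theory Submission
  imports Defs
begin

text \<open>
  Let \<open>C\<close> be the convex cone over \<open>K\<close>. The boundary segment of \<open>K\<close> spans a supporting plane of
  \<open>C\<close> with outer normal \<open>n\<close>, and \<open>C\<close> meets this plane in a two-dimensional facet. Let \<open>m\<close> be the
  bisector of the facet and \<open>e\<close> the unit vector of the plane orthogonal to \<open>m\<close>; the facet is
  \<open>{y. n \<bullet> y = 0 \<and> \<bar>e \<bullet> y\<bar> \<le> U * (m \<bullet> y)}\<close> for some \<open>U > 0\<close>. Light sources are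
  the directions of the vectors \<open>x(s, \<tau>) = s e + m + \<tau> n\<close> with \<open>\<bar>s\<bar> < U\<close> and small
  \<open>\<tau> > 0\<close>, which hover above the facet. The area that \<open>x\<close> adds to \<open>K\<close> is three
  times the volume of \<open>((C + \<real>\<^sub>\<ge>\<^sub>0 x) - C) \<inter> B\<close>, where \<open>B\<close> is the unit ball.

  Stretch the direction \<open>n\<close> by \<open>1 / \<tau>\<close>. Then the apex stands at height \<open>1\<close>, the cone
  \<open>C\<close> degenerates to the part of space below the facet, and \<open>B\<close> becomes a cylinder. To first order
  in \<open>\<tau>\<close>, the added volume is therefore \<open>\<tau>\<close> times the volume of a fixed body, the tent
  over the facet with apex \<open>s e + m + n\<close> inside the unit cylinder. The boundary of \<open>K\<close> may leave the
  segment tangentially, so that light also reaches beyond its ends; this contributes only a smaller order.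
  The upper estimate is \<open>gain_volume_upper\<close>, the lower one is \<open>gain_volume_lower\<close>.

  The point is that the tent with central apex has a strictly larger volume than the tents with
  apex moved sideways (\<open>tent_volume_centred_greater\<close>). After a shear, moving the apex sideways
  amounts to moving the cylinder sideways over a fixed symmetric tent, and the cylinder captures
  most when it is centred. Now \<open>x(0, \<tau>)\<close> is the midpoint of \<open>x(s, \<tau>)\<close> and
  \<open>x(- s, \<tau>)\<close>. For \<open>\<delta>\<close> between the central and the lateral added area, which is a
  suitable multiple of \<open>\<tau>\<close>, the two outer points belong to the illumination body, and the
  point between them on their geodesic does not. In classical terms: the apexes of triangles of
  given area over a given base form an arc of Lexell's circle, and the points of smaller area
  are locally the outside of this circle.
\<close>

section \<open>Tents over a symmetric sector\<close>

text \<open>In the stretched coordinates \<open>(e, m, n / \<tau>)\<close>: the cone spanned by the facet and an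
  apex of height \<open>1\<close> over the point \<open>(s, 1)\<close>, cut by the unit cylinder. Both side
  conditions are combined in one absolute value because \<open>v$1 - s * v$3\<close> and \<open>v$2 - v$3\<close>
  are the coordinates of the projection along the direction \<open>(s, 1, 1)\<close> of the apex.\<close>

definition tent :: "real \<Rightarrow> real \<Rightarrow> (real ^ 3) set" where
  "tent U s = {v. 0 \<le> v$3 \<and> (v$1)\<^sup>2 + (v$2)\<^sup>2 \<le> 1 \<and> \<bar>v$1 - s * v$3\<bar> \<le> U * (v$2 - v$3)}"

text \<open>An outer approximation for the light that passes the ends of the facet. The base is opened
  from \<open>U\<close> to \<open>U'\<close>, and below the facet there remain two thin wings, between the planes
  through the apex and the old, respectively the new, edges of the sector.\<close>

definition winged_tent :: "real \<Rightarrow> real \<Rightarrow> real \<Rightarrow> (real ^ 3) set" where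
  "winged_tent U U' s = {v. (v$1)\<^sup>2 + (v$2)\<^sup>2 \<le> 1 \<and> \<bar>v$1 - s * v$3\<bar> \<le> U' * (v$2 - v$3) \<and>
     (0 \<le> v$3 \<or> U * (v$2 - v$3) < \<bar>v$1 - s * v$3\<bar>)}"

lemma bounded_by_coordinates:
  fixes S :: "(real ^ 3) set"
  assumes "\<And>v. v \<in> S \<Longrightarrow> \<bar>v$1\<bar> \<le> B" "\<And>v. v \<in> S \<Longrightarrow> \<bar>v$2\<bar> \<le> B" "\<And>v. v \<in> S \<Longrightarrow> \<bar>v$3\<bar> \<le> B"
  shows "bounded S"
proof (rule boundedI)
  fix v assume v: "v \<in> S"
  have "norm v \<le> (\<Sum>i\<in>UNIV. \<bar>v$i\<bar>)" by (rule norm_le_l1_cart)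
  also have "\<dots> \<le> 3 * B" using assms[OF v] by (simp add: sum_3)
  finally show "norm v \<le> 3 * B" .
qed

lemma abs_coordinates_le_1:
  fixes x y :: real
  assumes "x\<^sup>2 + y\<^sup>2 \<le> 1"
  shows "\<bar>x\<bar> \<le> 1" "\<bar>y\<bar> \<le> 1"
proof -
  have "x\<^sup>2 \<le> 1" "y\<^sup>2 \<le> 1" using assms zero_le_power2[of x] zero_le_power2[of y] by linarith+
  then show "\<bar>x\<bar> \<le> 1" "\<bar>y\<bar> \<le> 1" by (simp_all add: abs_square_le_1)
qed

text \<open>The wings do not extend far down: the planes bounding them are graphs over the unit disc,
  and their slopes are controlled by \<open>U - \<bar>s\<bar>\<close>.\<close>

lemma bounded_winged_tent:
  assumes "\<bar>s\<bar> < U" "U \<le> U'"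
  shows "bounded (winged_tent U U' s)"
proof (rule bounded_by_coordinates)
  fix v assume v: "v \<in> winged_tent U U' s"
  define B where "B = 1 + (1 + U') / (U - \<bar>s\<bar>)"
  have d: "0 < U - \<bar>s\<bar>" "0 < U'" using assms by auto
  have B1: "1 \<le> B" unfolding B_def using d by simp
  note c = abs_coordinates_le_1[of "v$1" "v$2"]
  have c1: "\<bar>v$1\<bar> \<le> 1" and c2: "\<bar>v$2\<bar> \<le> 1" using v c by (auto simp: winged_tent_def)
  show "\<bar>v$1\<bar> \<le> B" "\<bar>v$2\<bar> \<le> B" using c1 c2 B1 by linarith+
  have sv: "\<bar>s * v$3\<bar> = \<bar>s\<bar> * \<bar>v$3\<bar>" by (rule abs_mult)
  have "0 \<le> U' * (v$2 - v$3)" using v by (auto simp: winged_tent_def)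
  then have le1: "v$3 \<le> 1" using c2 d by (auto simp: zero_le_mult_iff)
  show "\<bar>v$3\<bar> \<le> B"
  proof (cases "0 \<le> v$3")
    case True then show ?thesis using le1 B1 by linarith
  next
    case False
    then have "U * (v$2 - v$3) < \<bar>v$1 - s * v$3\<bar>" using v by (auto simp: winged_tent_def)
    also have "\<dots> \<le> 1 + \<bar>s\<bar> * \<bar>v$3\<bar>" using c1 sv by linarith
    finally have "U * v$2 + U * \<bar>v$3\<bar> < 1 + \<bar>s\<bar> * \<bar>v$3\<bar>" using False by (simp add: algebra_simps)
    moreover have "- U \<le> U * v$2" using c2 assms mult_left_mono[of "-1" "v$2" U] by auto
    ultimately have "(U - \<bar>s\<bar>) * \<bar>v$3\<bar> < 1 + U" by (simp add: algebra_simps)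
    then have "\<bar>v$3\<bar> < (1 + U) / (U - \<bar>s\<bar>)" using d by (simp add: field_simps)
    also have "\<dots> \<le> (1 + U') / (U - \<bar>s\<bar>)" using assms d by (simp add: divide_right_mono)
    finally show ?thesis by (simp add: B_def)
  qed
qed

lemma winged_tent_measurable:
  assumes "\<bar>s\<bar> < U" "U \<le> U'"
  shows "winged_tent U U' s \<in> lmeasurable"
proof -
  have "winged_tent U U' s \<in> sets borel" unfolding winged_tent_def by measurable
  then have "winged_tent U U' s \<in> sets lebesgue" by simp
  then show ?thesis using bounded_winged_tent[OF assms] bounded_set_imp_lmeasurable by blast
qed

lemma tent_eq_winged_tent: "tent U s = winged_tent U U s"
  by (auto simp: tent_def winged_tent_def)

lemma tent_measurable: "\<bar>s\<bar> < U \<Longrightarrow> tent U s \<in> lmeasurable"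
  by (simp add: tent_eq_winged_tent winged_tent_measurable)

lemma winged_tent_mono:
  assumes "0 < U'" "U' \<le> U''"
  shows "winged_tent U U' s \<subseteq> winged_tent U U'' s"
proof
  fix v assume v: "v \<in> winged_tent U U' s"
  then have "0 \<le> U' * (v$2 - v$3)" by (auto simp: winged_tent_def)
  then have "0 \<le> v$2 - v$3" using assms by (simp add: zero_le_mult_iff)
  then have "U' * (v$2 - v$3) \<le> U'' * (v$2 - v$3)" using assms mult_right_mono by blast
  then show "v \<in> winged_tent U U'' s" using v by (auto simp: winged_tent_def)
qed

text \<open>The wings close up as \<open>U'\<close> decreases to \<open>U\<close>, so continuity of the measure from above
  replaces every estimate of their volume.\<close>

lemma winged_tent_volume_tendsto:
  assumes "\<bar>s\<bar> < U"
  shows "(\<lambda>k. measure lebesgue (winged_tent U (U + 1 / real (Suc k)) s))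
    \<longlonglongrightarrow> measure lebesgue (tent U s)"
proof -
  let ?W = "\<lambda>k. winged_tent U (U + 1 / real (Suc k)) s"
  have U: "0 < U" using assms by auto
  have lm: "?W k \<in> lmeasurable" for k using assms by (intro winged_tent_measurable) auto
  have "(\<lambda>k. measure lebesgue (?W k)) \<longlonglongrightarrow> measure lebesgue (\<Inter>k. ?W k)"
  proof (rule Lim_measure_decseq)
    show "range ?W \<subseteq> sets lebesgue" using lm by blast
    show "decseq ?W" unfolding decseq_def
      using U by (intro allI impI winged_tent_mono) (auto intro: add_pos_nonneg simp: frac_le)
    show "emeasure lebesgue (?W i) \<noteq> \<infinity>" for i unfolding infinity_ennreal_def by (rule fmeasurableD2[OF lm])
  qed
  moreover have "(\<Inter>k. ?W k) = tent U s"
  proof (intro equalityI subsetI)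
    fix v assume "v \<in> tent U s"
    then have "v \<in> winged_tent U U s" by (simp add: tent_eq_winged_tent)
    then show "v \<in> (\<Inter>k. ?W k)" using winged_tent_mono[OF U, of "U + 1 / real (Suc k)" U s for k] 
      by (auto simp: add.commute)
  next
    fix v assume v: "v \<in> (\<Inter>k. ?W k)"
    have "(\<lambda>k. (U + 1 / real (Suc k)) * (v$2 - v$3)) \<longlonglongrightarrow> (U + 0) * (v$2 - v$3)"
      by (intro tendsto_intros LIMSEQ_Suc[OF lim_1_over_n])
    moreover have "\<bar>v$1 - s * v$3\<bar> \<le> (U + 1 / real (Suc k)) * (v$2 - v$3)" for k
      using v unfolding winged_tent_def by blast
    ultimately have "\<bar>v$1 - s * v$3\<bar> \<le> (U + 0) * (v$2 - v$3)"
      using LIMSEQ_le_const by blast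
    then show "v \<in> tent U s" using v by (auto simp: tent_def winged_tent_def)
  qed
  ultimately show ?thesis by simp
qed

text \<open>With \<open>a = 1\<close> this is the shear that moves the apex sideways; with \<open>a = - 1\<close> it is a
  reflection in an oblique direction.\<close>

definition skew :: "real \<Rightarrow> real \<Rightarrow> real ^ 3 \<Rightarrow> real ^ 3" where
  "skew a s v = vector [a * v$1 + s * v$3, v$2, v$3]"

lemma skew_nth [simp]: "skew a s v $ 1 = a * v$1 + s * v$3" "skew a s v $ 2 = v$2" "skew a s v $ 3 = v$3"
  by (simp_all add: skew_def)

lemma vec3_eq_iff: "(v :: real ^ 3) = w \<longleftrightarrow> v$1 = w$1 \<and> v$2 = w$2 \<and> v$3 = w$3"
  by (simp add: vec_eq_iff forall_3)

lemma measure_skew_image: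
  assumes "S \<in> lmeasurable" "\<bar>a\<bar> = 1"
  shows "skew a s ` S \<in> lmeasurable" "measure lebesgue (skew a s ` S) = measure lebesgue S"
proof -
  have lin: "linear (skew a s)"
    by (rule linearI) (simp_all add: vec3_eq_iff algebra_simps)
  have "det (matrix (skew a s)) = a" by (simp add: det_3 matrix_def axis_def)
  then show "skew a s ` S \<in> lmeasurable" "measure lebesgue (skew a s ` S) = measure lebesgue S"
    using measurable_linear_image[OF lin assms(1)] measure_linear_image[OF lin assms(1)] assms(2) by simp_all
qed

text \<open>Shearing the apex to the centre turns \<open>tent U s\<close> into the set \<open>B\<close> of the points of the
  central tent shape over the sector that lie in the cylinder displaced by \<open>- s * v$3\<close> at height \<open>v$3\<close>,
  while \<open>A = tent U 0\<close> uses the straight cylinder. On each line in direction \<open>v$1\<close> this compares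
  the intersections of a symmetric interval with a centred and with a displaced interval of the
  same length. The reflection \<open>v$1 \<mapsto> - v$1 - s * v$3\<close> exchanges the two
  cylinders and carries \<open>B - A\<close> into \<open>A - B\<close>; since it preserves volume, it suffices that
  it misses an open part \<open>G\<close> of \<open>A - B\<close>.\<close>

lemma tent_volume_centred_greater:
  assumes "0 < s" "s < U"
  shows "measure lebesgue (tent U s) < measure lebesgue (tent U 0)"
proof -
  define A where "A = tent U 0"
  define B where "B = skew 1 (- s) ` tent U s"
  have lmA: "A \<in> lmeasurable" using tent_measurable assms by (simp add: A_def)
  have lmB: "B \<in> lmeasurable" and mB: "measure lebesgue B = measure lebesgue (tent U s)"
    using measure_skew_image[of "tent U s" 1 "-s"] tent_measurable[of s U] assms by (auto simp: B_def)
  have B: "v \<in> B \<longleftrightarrow> 0 \<le> v$3 \<and> (v$1 + s * v$3)\<^sup>2 + (v$2)\<^sup>2 \<le> 1 \<and> \<bar>v$1\<bar> \<le> U * (v$2 - v$3)" (is "_ \<longleftrightarrow> ?P v") for v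
  proof
    assume "v \<in> B" then show "?P v" by (auto simp: B_def tent_def)
  next
    assume "?P v"
    then have "skew 1 s v \<in> tent U s" "v = skew 1 (- s) (skew 1 s v)"
      by (simp_all add: tent_def vec3_eq_iff)
    then show "v \<in> B" unfolding B_def by blast
  qed
  have A: "v \<in> A \<longleftrightarrow> 0 \<le> v$3 \<and> (v$1)\<^sup>2 + (v$2)\<^sup>2 \<le> 1 \<and> \<bar>v$1\<bar> \<le> U * (v$2 - v$3)" for v
    by (auto simp: A_def tent_def)
  let ?r = "skew (- 1) (- s)"
  define G where "G = {v :: real ^ 3. 0 < v$3 \<and> (v$1)\<^sup>2 + (v$2)\<^sup>2 < 1 \<and> \<bar>v$1\<bar> < U * (v$2 - v$3) \<and>
    1 < (v$1 + s * v$3)\<^sup>2 + (v$2)\<^sup>2 \<and> U * (v$2 - v$3) < \<bar>v$1 + s * v$3\<bar>}"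
  have sub: "?r ` (B - A) \<subseteq> A - B"
  proof (rule image_subsetI)
    fix v assume v: "v \<in> B - A"
    then have "1 < (v$1)\<^sup>2 + (v$2)\<^sup>2" "(v$1 + s * v$3)\<^sup>2 + (v$2)\<^sup>2 \<le> 1" by (auto simp: A B)
    then have "(v$1 + s * v$3)\<^sup>2 < (v$1)\<^sup>2" by linarith
    then have "\<bar>v$1 + s * v$3\<bar> < \<bar>v$1\<bar>" by (metis abs_le_square_iff linorder_not_le)
    then have "\<bar>- v$1 - s * v$3\<bar> < \<bar>v$1\<bar>" "(- v$1 - s * v$3)\<^sup>2 = (v$1 + s * v$3)\<^sup>2"
      by (simp_all add: power2_eq_square algebra_simps)
    then show "?r v \<in> A - B" using v by (auto simp: A B)
  qed
  have G_sub: "G \<subseteq> A - B" by (auto simp: A B G_def)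
  have disj: "?r ` (B - A) \<inter> G = {}"
    by (auto simp: B G_def)
  have "open G" unfolding G_def by (intro open_Collect_conj open_Collect_less continuous_intros)
  moreover have "G \<noteq> {}"
  proof -
    \<comment> \<open>A point of the cylinder wall is \<open>(U * p / 2, p)\<close>, with half the slope of the sector. At height \<open>p / 2\<close> the tent reaches exactly up to it; the displacement is \<open>s * p / 2\<close>, of which \<open>v\<close> uses half to move inwards.\<close>
    define p where "p = 1 / sqrt (1 + U\<^sup>2 / 4)"
    have pos: "0 < 1 + U\<^sup>2 / 4" by (simp add: add_pos_nonneg)
    have p: "0 < p" "p\<^sup>2 * (1 + U\<^sup>2 / 4) = 1" unfolding p_def using pos by (simp_all add: power_divide)
    have U: "0 < U" using assms by linarith
    have sp: "0 < s * p" "s * p < U * p" using assms p by (simp_all)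
    define v :: "real ^ 3" where "v = vector [U * p / 2 - s * p / 4, p, p / 2]"
    have v: "v$1 = U * p / 2 - s * p / 4" "v$2 = p" "v$3 = p / 2" by (simp_all add: v_def)
    have eq: "(U * p / 2)\<^sup>2 + p\<^sup>2 = 1" using p by (simp add: power2_eq_square algebra_simps)
    have 1: "(v$1)\<^sup>2 < (U * p / 2)\<^sup>2" unfolding v by (intro power_strict_mono) (use sp in \<open>simp_all add: mult.commute\<close>)
    have 2: "(U * p / 2)\<^sup>2 < (U * p / 2 + s * p / 4)\<^sup>2" using sp by (intro power_strict_mono) auto
    have e: "v$1 + s * v$3 = U * p / 2 + s * p / 4" unfolding v by simp
    have "v \<in> G" unfolding G_def mem_Collect_eq e using 1 2 eq sp p(1) U unfolding v
      by (auto simp: algebra_simps abs_if)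
    then show ?thesis by blast
  qed
  ultimately have "\<not> negligible G" using open_not_negligible by blast
  have "bounded G" using bounded_subset[OF bounded_winged_tent[of 0 U U]] G_sub assms
    tent_eq_winged_tent by (auto simp: A_def)
  then have lmG: "G \<in> lmeasurable" using \<open>open G\<close> lmeasurable_open by blast
  have mG: "0 < measure lebesgue G"
    using \<open>\<not> negligible G\<close> lmG by (simp add: negligible_iff_measure zero_less_measure_iff)
  have BA: "B - A \<in> lmeasurable" and AB: "A - B \<in> lmeasurable" using lmA lmB fmeasurable.Diff by blast+
  have r: "?r ` (B - A) \<in> lmeasurable" "measure lebesgue (?r ` (B - A)) = measure lebesgue (B - A)"
    using measure_skew_image[OF BA, of "-1" "-s"] by auto
  have "measure lebesgue (B - A) + measure lebesgue G = measure lebesgue (?r ` (B - A) \<union> G)"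
    using measure_Un_AE r lmG disj by (simp add: measure_Un3 disj)
  also have "\<dots> \<le> measure lebesgue (A - B)"
    using sub G_sub r lmG AB by (intro measure_mono_fmeasurable) auto
  finally have "measure lebesgue (B - A) < measure lebesgue (A - B)" using mG by linarith
  moreover have "measure lebesgue A + measure lebesgue (B - A) = measure lebesgue B + measure lebesgue (A - B)"
    using measure_Un2[OF lmA lmB] measure_Un2[OF lmB lmA] by (simp add: Un_commute)
  ultimately show ?thesis using mB by (simp add: A_def)
qed

section \<open>First-order expansion of the added volume\<close>

definition cone_with :: "(real ^ 3) set \<Rightarrow> real ^ 3 \<Rightarrow> (real ^ 3) set" where
  "cone_with C x = {c + t *\<^sub>R x | c t. c \<in> C \<and> 0 \<le> t}"

text \<open>The solid whose volume is a third of the area that a light source in direction \<open>x\<close> adds to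
  the section of the cone \<open>C\<close> with the sphere.\<close>

definition gain :: "(real ^ 3) set \<Rightarrow> real ^ 3 \<Rightarrow> (real ^ 3) set" where
  "gain C x = (cone_with C x - C) \<inter> cball 0 1"

lemma convex_conic_add:
  assumes "convex C" "conic C" "a \<in> C" "b \<in> C"
  shows "a + b \<in> C"
  using assms by (intro convex_cone_add) (auto simp: convex_cone_def)

lemma convex_cone_with:
  assumes "convex C" "conic C"
  shows "convex (cone_with C x)"
proof (rule convexI)
  fix a b :: "real ^ 3" and u v :: real
  assume "a \<in> cone_with C x" "b \<in> cone_with C x" and uv: "0 \<le> u" "0 \<le> v" "u + v = 1"
  then obtain c t d r where c: "a = c + t *\<^sub>R x" "c \<in> C" "0 \<le> t" and d: "b = d + r *\<^sub>R x" "d \<in> C" "0 \<le> r"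
    by (auto simp: cone_with_def)
  have "u *\<^sub>R a + v *\<^sub>R b = (u *\<^sub>R c + v *\<^sub>R d) + (u * t + v * r) *\<^sub>R x"
    by (simp add: c d algebra_simps)
  moreover have "u *\<^sub>R c + v *\<^sub>R d \<in> C" using assms(1) c d uv by (simp add: convexD)
  moreover have "0 \<le> u * t + v * r" using c d uv by simp
  ultimately show "u *\<^sub>R a + v *\<^sub>R b \<in> cone_with C x" unfolding cone_with_def by blast
qed

lemma conic_cone_with:
  assumes "conic C"
  shows "conic (cone_with C x)"
  unfolding conic_def
proof (intro allI impI)
  fix a and r :: real assume "a \<in> cone_with C x" "0 \<le> r"
  then obtain c t where c: "a = c + t *\<^sub>R x" "c \<in> C" "0 \<le> t" by (auto simp: cone_with_def)
  have "r *\<^sub>R a = r *\<^sub>R c + (r * t) *\<^sub>R x" by (simp add: c algebra_simps)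
  moreover have "r *\<^sub>R c \<in> C" using assms c \<open>0 \<le> r\<close> by (simp add: conic_def)
  ultimately show "r *\<^sub>R a \<in> cone_with C x" using c \<open>0 \<le> r\<close> unfolding cone_with_def by fastforce
qed

text \<open>A difference of two bounded convex sets, which are measurable because their frontiers are
  null sets.\<close>

lemma gain_measurable:
  assumes "convex C" "conic C"
  shows "gain C x \<in> lmeasurable"
proof -
  have "gain C x = (cone_with C x \<inter> cball 0 1) - (C \<inter> cball 0 1)" by (auto simp: gain_def)
  moreover have "cone_with C x \<inter> cball 0 1 \<in> lmeasurable" "C \<inter> cball 0 1 \<in> lmeasurable"
    using assms by (auto intro!: measurable_convex convex_Int convex_cone_with bounded_Int)
  ultimately show ?thesis using fmeasurable.Diff by simp
qed

locale orthonormal_frame =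
  fixes e m n :: "real ^ 3"
  assumes unit: "norm e = 1" "norm m = 1" "norm n = 1"
    and orth: "e \<bullet> m = 0" "e \<bullet> n = 0" "m \<bullet> n = 0"
begin

text \<open>Undoes the stretching of the normal direction by \<open>1 / \<tau>\<close>: maps the stretched
  coordinates back to the original space.\<close>

definition frame_map :: "real \<Rightarrow> real ^ 3 \<Rightarrow> real ^ 3" where
  "frame_map \<tau> v = v$1 *\<^sub>R e + v$2 *\<^sub>R m + (\<tau> * v$3) *\<^sub>R n"

lemma frame_inner: "e \<bullet> e = 1" "m \<bullet> m = 1" "n \<bullet> n = 1" "m \<bullet> e = 0" "n \<bullet> e = 0" "n \<bullet> m = 0"
  using unit orth by (simp_all add: norm_eq_1 inner_commute)

lemma orthogonal_frame_map: "orthogonal_transformation (frame_map 1)"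
  unfolding orthogonal_transformation_def
proof
  show "linear (frame_map 1)" unfolding frame_map_def by (rule linearI) (simp_all add: algebra_simps)
  show "\<forall>v w. frame_map 1 v \<bullet> frame_map 1 w = v \<bullet> w"
  proof (intro allI)
    fix v w :: "real ^ 3"
    have "v \<bullet> w = v$1 * w$1 + v$2 * w$2 + v$3 * w$3" by (simp add: inner_vec_def sum_3)
    moreover have "frame_map 1 v \<bullet> frame_map 1 w = v$1 * w$1 + v$2 * w$2 + v$3 * w$3"
      unfolding frame_map_def by (simp add: inner_add_left inner_add_right frame_inner orth)
    ultimately show "frame_map 1 v \<bullet> frame_map 1 w = v \<bullet> w" by simp
  qed
qed

lemma measure_frame_map_image:
  assumes "S \<in> lmeasurable" "0 \<le> \<tau>"
  shows "frame_map \<tau> ` S \<in> lmeasurable" "measure lebesgue (frame_map \<tau> ` S) = \<tau> * measure lebesgue S"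
proof -
  define k :: "3 \<Rightarrow> real" where "k = ($) (vector [1, 1, \<tau>])"
  have k: "k 1 = 1" "k 2 = 1" "k 3 = \<tau>" by (simp_all add: k_def)
  let ?f = "\<lambda>v :: real ^ 3. \<chi> i. k i * v$i"
  have eq: "frame_map \<tau> ` S = frame_map 1 ` (?f ` S)"
    unfolding image_image frame_map_def by (simp add: k)
  have p: "\<bar>prod k UNIV\<bar> = \<tau>" unfolding UNIV_3 using assms(2) by (simp add: k)
  note f = measurable_stretch[OF assms(1), of k] measure_stretch[OF assms(1), of k, unfolded p]
  show "frame_map \<tau> ` S \<in> lmeasurable"
    unfolding eq by (rule measurable_orthogonal_image[OF orthogonal_frame_map f(1)])
  show "measure lebesgue (frame_map \<tau> ` S) = \<tau> * measure lebesgue S"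
    unfolding eq measure_orthogonal_image[OF orthogonal_frame_map f(1)] by (rule f(2))
qed

lemma frame_expansion: "y = (e \<bullet> y) *\<^sub>R e + (m \<bullet> y) *\<^sub>R m + (n \<bullet> y) *\<^sub>R n"
proof -
  obtain v where "y = frame_map 1 v"
    using orthogonal_transformation_surj[OF orthogonal_frame_map] by (metis surjD)
  then show ?thesis
    by (simp add: frame_map_def inner_add_right frame_inner orth)
qed

lemma frame_norm: "(norm y)\<^sup>2 = (e \<bullet> y)\<^sup>2 + (m \<bullet> y)\<^sup>2 + (n \<bullet> y)\<^sup>2"
proof -
  have "y \<bullet> y = (e \<bullet> y) * (e \<bullet> y) + (m \<bullet> y) * (m \<bullet> y) + (n \<bullet> y) * (n \<bullet> y)"
    by (subst (1) frame_expansion) (simp add: inner_add_left)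
  then show ?thesis unfolding power2_norm_eq_inner by (simp add: power2_eq_square)
qed

end

text \<open>A closed convex cone that lies below the plane orthogonal to \<open>n\<close> and touches it in a
  sector with bisector \<open>m\<close> and half-angle \<open>arctan U\<close>.\<close>

locale facet_cone = orthonormal_frame +
  fixes C :: "(real ^ 3) set" and U :: real
  assumes convex: "convex C" and conic: "conic C" and closed: "closed C"
    and U_pos: "0 < U"
    and below: "y \<in> C \<Longrightarrow> n \<bullet> y \<le> 0"
    and facet: "n \<bullet> y = 0 \<Longrightarrow> y \<in> C \<longleftrightarrow> \<bar>e \<bullet> y\<bar> \<le> U * (m \<bullet> y)"
begin

definition apex :: "real \<Rightarrow> real \<Rightarrow> real ^ 3" where
  "apex s \<tau> = s *\<^sub>R e + m + \<tau> *\<^sub>R n"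

lemma apex_inner: "e \<bullet> apex s \<tau> = s" "m \<bullet> apex s \<tau> = 1" "n \<bullet> apex s \<tau> = \<tau>"
  by (simp_all add: apex_def inner_add_right frame_inner orth)

text \<open>The inequality describes the two planes through \<open>apex s \<tau>\<close> and one of the rays
  \<open>m \<plusminus> U' e\<close> just outside the facet. As \<open>\<tau>\<close> tends to \<open>0\<close> they approach
  the supporting plane. The cone stays below them: over the opened sector because the planes are
  above the supporting plane there, and elsewhere because, by compactness, the cone keeps a positive distance \<open>h\<close>
  from the supporting plane.\<close>

lemma tilted_planes_bound_cone:
  assumes s: "\<bar>s\<bar> < U" and U': "U < U'"
  shows "\<exists>\<tau>\<^sub>0>0. \<forall>\<tau> c. 0 < \<tau> \<longrightarrow> \<tau> < \<tau>\<^sub>0 \<longrightarrow> c \<in> C \<longrightarrow> 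
    \<bar>\<tau> * (e \<bullet> c) - s * (n \<bullet> c)\<bar> \<le> U' * (\<tau> * (m \<bullet> c) - n \<bullet> c)"
proof -
  \<comment> \<open>The directions of the cone over the closed complement of the opened sector; they are strictly below the supporting plane.\<close>
  define F where "F = (C \<inter> sphere 0 1) \<inter> {c. U' * (m \<bullet> c) \<le> \<bar>e \<bullet> c\<bar>}"
  have "compact F" unfolding F_def
    by (intro compact_Int_closed closed_Int_compact closed compact_sphere closed_Collect_le continuous_intros)
  have neg: "n \<bullet> c < 0" if "c \<in> F" for c
  proof (rule ccontr)
    assume "\<not> n \<bullet> c < 0"
    then have z: "n \<bullet> c = 0" using below[of c] that by (auto simp: F_def)
    then have le: "\<bar>e \<bullet> c\<bar> \<le> U * (m \<bullet> c)" using facet[OF z] that by (auto simp: F_def)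
    then have "0 \<le> U * (m \<bullet> c)" by linarith
    then have "0 \<le> m \<bullet> c" using U_pos by (simp add: zero_le_mult_iff)
    moreover have "(U' - U) * (m \<bullet> c) \<le> 0" using le that by (auto simp: F_def algebra_simps)
    ultimately have "m \<bullet> c = 0" using U' by (simp add: mult_le_0_iff)
    then have "e \<bullet> c = 0" using le by simp
    then have "norm c = 0" using frame_norm[of c] z \<open>m \<bullet> c = 0\<close> by simp
    then show False using that by (simp add: F_def)
  qed
  obtain h where h: "0 < h" "\<And>c. c \<in> F \<Longrightarrow> n \<bullet> c \<le> - h"
  proof (cases "F = {}")
    case True then show ?thesis using that[of 1] by auto
  next
    case False
    have "continuous_on F (\<lambda>c. n \<bullet> c)" by (intro continuous_intros)
    then obtain c where c: "c \<in> F" "\<And>d. d \<in> F \<Longrightarrow> n \<bullet> d \<le> n \<bullet> c" 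
      using continuous_attains_sup[OF \<open>compact F\<close> False, of "\<lambda>c. n \<bullet> c"] by blast
    then show ?thesis using that[of "- (n \<bullet> c)"] neg by auto
  qed
  \<comment> \<open>On \<open>F\<close> the horizontal terms are at most \<open>\<tau> * (1 + U')\<close> and the vertical ones at least \<open>(U' - \<bar>s\<bar>) * h\<close>.\<close>
  define \<tau>\<^sub>0 where "\<tau>\<^sub>0 = (U' - \<bar>s\<bar>) * h / (1 + U')"
  have "0 < \<tau>\<^sub>0" unfolding \<tau>\<^sub>0_def using s U' U_pos h by simp
  have unit_case: "\<bar>\<tau> * (e \<bullet> c) - s * (n \<bullet> c)\<bar> \<le> U' * (\<tau> * (m \<bullet> c) - n \<bullet> c)"
    if \<tau>: "0 < \<tau>" "\<tau> < \<tau>\<^sub>0" and c: "c \<in> C" "norm c = 1" for \<tau> c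
  proof -
    define z where "z = - (n \<bullet> c)"
    have z: "0 \<le> z" using below c by (simp add: z_def)
    have tri: "\<bar>\<tau> * (e \<bullet> c) - s * (n \<bullet> c)\<bar> \<le> \<tau> * \<bar>e \<bullet> c\<bar> + \<bar>s\<bar> * z"
      using abs_triangle_ineq[of "\<tau> * (e \<bullet> c)" "s * z"] \<tau> z by (simp add: abs_mult z_def)
    show ?thesis
    proof (cases "c \<in> F")
      case True
      have "\<bar>e \<bullet> c\<bar> \<le> 1" "\<bar>m \<bullet> c\<bar> \<le> 1"
        using Cauchy_Schwarz_ineq2[of e c] Cauchy_Schwarz_ineq2[of m c] unit c by simp_all
      then have "\<tau> * \<bar>e \<bullet> c\<bar> \<le> \<tau> * 1" "(U' * \<tau>) * (- 1) \<le> (U' * \<tau>) * (m \<bullet> c)"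
        using \<tau> U' U_pos by (intro mult_left_mono; force)+
      moreover have "\<tau> * (1 + U') \<le> (U' - \<bar>s\<bar>) * h"
        using \<tau> U' U_pos unfolding \<tau>\<^sub>0_def by (simp add: field_simps)
      moreover have "(U' - \<bar>s\<bar>) * h \<le> (U' - \<bar>s\<bar>) * z"
        using h(2)[OF True] s U' by (intro mult_left_mono) (auto simp: z_def)
      ultimately have "\<tau> * \<bar>e \<bullet> c\<bar> + \<bar>s\<bar> * z \<le> U' * \<tau> * (m \<bullet> c) + U' * z" by (simp add: algebra_simps)
      then show ?thesis using tri by (simp add: z_def algebra_simps)
    next
      case False
      then have "\<bar>e \<bullet> c\<bar> \<le> U' * (m \<bullet> c)" using c by (auto simp: F_def)
      then have "\<tau> * \<bar>e \<bullet> c\<bar> \<le> \<tau> * (U' * (m \<bullet> c))" using \<tau> by (intro mult_left_mono) auto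
      moreover have "\<bar>s\<bar> * z \<le> U' * z" using s U' z by (intro mult_right_mono) auto
      ultimately show ?thesis using tri by (simp add: z_def algebra_simps)
    qed
  qed
  have "\<bar>\<tau> * (e \<bullet> c) - s * (n \<bullet> c)\<bar> \<le> U' * (\<tau> * (m \<bullet> c) - n \<bullet> c)"
    if \<tau>: "0 < \<tau>" "\<tau> < \<tau>\<^sub>0" and c: "c \<in> C" for \<tau> c
  proof (cases "c = 0")
    case False
    define r where "r = norm c"
    define u where "u = c /\<^sub>R r"
    have r: "0 < r" and cu: "c = r *\<^sub>R u" and "norm u = 1" using False by (simp_all add: r_def u_def)
    have "u \<in> C" using conic c r by (simp add: u_def conic_def)
    from unit_case[OF \<tau> this \<open>norm u = 1\<close>]
    have "r * \<bar>\<tau> * (e \<bullet> u) - s * (n \<bullet> u)\<bar> \<le> r * (U' * (\<tau> * (m \<bullet> u) - n \<bullet> u))"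
      using r by simp
    also have "\<dots> = U' * (\<tau> * (m \<bullet> c) - n \<bullet> c)" by (simp add: cu algebra_simps)
    also have "r * \<bar>\<tau> * (e \<bullet> u) - s * (n \<bullet> u)\<bar> = \<bar>r * (\<tau> * (e \<bullet> u) - s * (n \<bullet> u))\<bar>"
      using r by (simp add: abs_mult)
    also have "r * (\<tau> * (e \<bullet> u) - s * (n \<bullet> u)) = \<tau> * (e \<bullet> c) - s * (n \<bullet> c)"
      by (simp add: cu algebra_simps)
    finally show ?thesis .
  qed simp
  then show ?thesis using \<open>0 < \<tau>\<^sub>0\<close> by blast
qed

text \<open>Below the facet, new points can only occur in the wings: follow the light ray through \<open>y\<close>
  up to the point \<open>p\<close> where it crosses the supporting plane. The projection along the apex
  does not change on the way, so \<open>p\<close> lies in the facet, and \<open>y\<close> lies between \<open>p\<close> and a point of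
  the cone.\<close>

lemma cone_with_apex_below_facet:
  assumes \<tau>: "0 < \<tau>" and y: "y \<in> cone_with C (apex s \<tau>)" "n \<bullet> y \<le> 0"
    and le: "\<bar>\<tau> * (e \<bullet> y) - s * (n \<bullet> y)\<bar> \<le> U * (\<tau> * (m \<bullet> y) - n \<bullet> y)"
  shows "y \<in> C"
proof -
  obtain c t where c: "y = c + t *\<^sub>R apex s \<tau>" "c \<in> C" "0 \<le> t" using y by (auto simp: cone_with_def)
  \<comment> \<open>The parameter at which the ray \<open>c + r *\<^sub>R apex s \<tau>\<close> reaches the supporting plane.\<close>
  define r where "r = - (n \<bullet> c) / \<tau>"
  have tr: "t \<le> r" using y(2) \<tau> by (simp add: c(1) inner_add_right apex_inner r_def field_simps)
  define p where "p = c + r *\<^sub>R apex s \<tau>"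
  have yc: "e \<bullet> y = e \<bullet> c + t * s" "m \<bullet> y = m \<bullet> c + t" "n \<bullet> y = n \<bullet> c + t * \<tau>"
    by (simp_all add: c(1) inner_add_right apex_inner)
  have pc: "e \<bullet> p = e \<bullet> c + r * s" "m \<bullet> p = m \<bullet> c + r" "n \<bullet> p = 0"
    using \<tau> unfolding p_def inner_add_right inner_scaleR_right apex_inner by (simp_all add: r_def)
  have "\<tau> * (e \<bullet> p) = \<tau> * (e \<bullet> y) - s * (n \<bullet> y)"
    unfolding yc pc r_def using \<tau> by (simp add: field_simps)
  then have "\<tau> * \<bar>e \<bullet> p\<bar> = \<bar>\<tau> * (e \<bullet> y) - s * (n \<bullet> y)\<bar>"
    using \<tau> by (metis abs_mult_pos' less_imp_le)
  moreover have "\<tau> * (U * (m \<bullet> p)) = U * (\<tau> * (m \<bullet> y) - n \<bullet> y)"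
    unfolding yc pc r_def using \<tau> by (simp add: field_simps)
  ultimately have "\<bar>e \<bullet> p\<bar> \<le> U * (m \<bullet> p)" using le \<tau> by (metis mult_le_cancel_left_pos)
  then have "p \<in> C" using facet pc(3) by blast
  show ?thesis
  proof (cases "r = 0")
    case True then show ?thesis using c tr by simp
  next
    case False
    then have r: "0 < r" using tr c(3) by linarith
    have "y = (1 - t / r) *\<^sub>R c + (t / r) *\<^sub>R p" using r by (simp add: c(1) p_def algebra_simps)
    then show ?thesis using \<open>p \<in> C\<close> c(2,3) r tr convex by (simp add: convexD_alt)
  qed
qed

lemma gain_subset_winged_tent:
  assumes s: "\<bar>s\<bar> < U" and U': "U < U'"
  shows "\<exists>\<tau>\<^sub>0>0. \<forall>\<tau>. 0 < \<tau> \<longrightarrow> \<tau> < \<tau>\<^sub>0 \<longrightarrow> gain C (apex s \<tau>) \<subseteq> frame_map \<tau> ` winged_tent U U' s"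
proof -
  obtain \<tau>\<^sub>0 where "0 < \<tau>\<^sub>0" and bound: "\<And>\<tau> c. 0 < \<tau> \<Longrightarrow> \<tau> < \<tau>\<^sub>0 \<Longrightarrow> c \<in> C \<Longrightarrow>
      \<bar>\<tau> * (e \<bullet> c) - s * (n \<bullet> c)\<bar> \<le> U' * (\<tau> * (m \<bullet> c) - n \<bullet> c)"
    using tilted_planes_bound_cone[OF assms] by blast
  have "y \<in> frame_map \<tau> ` winged_tent U U' s" if \<tau>: "0 < \<tau>" "\<tau> < \<tau>\<^sub>0" and y: "y \<in> gain C (apex s \<tau>)" for \<tau> y
  proof
    define v :: "real ^ 3" where "v = vector [e \<bullet> y, m \<bullet> y, (n \<bullet> y) / \<tau>]"
    have v: "v$1 = e \<bullet> y" "v$2 = m \<bullet> y" "v$3 = (n \<bullet> y) / \<tau>" by (simp_all add: v_def)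
    show "y = frame_map \<tau> v" using \<tau> frame_expansion[of y] by (simp add: frame_map_def v)
    obtain c t where c: "y = c + t *\<^sub>R apex s \<tau>" "c \<in> C" "0 \<le> t" 
      using y by (auto simp: gain_def cone_with_def)
    have "(norm y)\<^sup>2 \<le> 1" using y by (simp add: gain_def power_le_one)
    then have cyl: "(v$1)\<^sup>2 + (v$2)\<^sup>2 \<le> 1" using frame_norm[of y] zero_le_power2[of "n \<bullet> y"] by (simp only: v)
    have "\<tau> * (v$1 - s * v$3) = \<tau> * (e \<bullet> y) - s * (n \<bullet> y)"
      using \<tau> by (simp add: v field_simps)
    then have a: "\<tau> * \<bar>v$1 - s * v$3\<bar> = \<bar>\<tau> * (e \<bullet> y) - s * (n \<bullet> y)\<bar>"
      using \<tau> by (metis abs_mult_pos' less_imp_le)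
    have b: "\<tau> * (W * (v$2 - v$3)) = W * (\<tau> * (m \<bullet> y) - n \<bullet> y)" for W
      using \<tau> by (simp add: v field_simps)
    have "\<tau> * (e \<bullet> y) - s * (n \<bullet> y) = \<tau> * (e \<bullet> c) - s * (n \<bullet> c)"
      "\<tau> * (m \<bullet> y) - n \<bullet> y = \<tau> * (m \<bullet> c) - n \<bullet> c"
      by (simp_all add: c(1) inner_add_right apex_inner algebra_simps)
    then have "\<tau> * \<bar>v$1 - s * v$3\<bar> \<le> \<tau> * (U' * (v$2 - v$3))"
      using bound[OF \<tau> c(2)] by (simp only: a b)
    then have "\<bar>v$1 - s * v$3\<bar> \<le> U' * (v$2 - v$3)" using \<tau> by simp
    moreover have "U * (v$2 - v$3) < \<bar>v$1 - s * v$3\<bar>" if "v$3 < 0"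
    proof (rule ccontr)
      assume "\<not> ?thesis"
      then have "\<tau> * \<bar>v$1 - s * v$3\<bar> \<le> \<tau> * (U * (v$2 - v$3))" using \<tau> by simp
      moreover have "n \<bullet> y \<le> 0" using that \<tau> by (simp add: v divide_less_0_iff)
      ultimately have "y \<in> C" using y cone_with_apex_below_facet[OF \<tau>(1), of y s] 
        by (simp only: a b) (simp add: gain_def)
      then show False using y by (simp add: gain_def)
    qed
    ultimately show "v \<in> winged_tent U U' s" using cyl by (force simp: winged_tent_def)
  qed
  then show ?thesis using \<open>0 < \<tau>\<^sub>0\<close> by blast
qed

lemma gain_volume_upper:
  assumes s: "\<bar>s\<bar> < U" and c: "measure lebesgue (tent U s) < c"
  shows "\<exists>\<tau>\<^sub>0>0. \<forall>\<tau>. 0 < \<tau> \<longrightarrow> \<tau> < \<tau>\<^sub>0 \<longrightarrow> measure lebesgue (gain C (apex s \<tau>)) \<le> \<tau> * c"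
proof -
  obtain k where k: "measure lebesgue (winged_tent U (U + 1 / real (Suc k)) s) < c"
    using order_tendstoD(2)[OF winged_tent_volume_tendsto[OF s] c] eventually_sequentially by auto
  define U' where "U' = U + 1 / real (Suc k)"
  have U': "U < U'" by (simp add: U'_def)
  have lm: "winged_tent U U' s \<in> lmeasurable" using winged_tent_measurable[OF s] U' by simp
  obtain \<tau>\<^sub>0 where "0 < \<tau>\<^sub>0" and sub: "\<And>\<tau>. 0 < \<tau> \<Longrightarrow> \<tau> < \<tau>\<^sub>0 \<Longrightarrow> gain C (apex s \<tau>) \<subseteq> frame_map \<tau> ` winged_tent U U' s"
    using gain_subset_winged_tent[OF s U'] by blast
  have "measure lebesgue (gain C (apex s \<tau>)) \<le> \<tau> * c" if \<tau>: "0 < \<tau>" "\<tau> < \<tau>\<^sub>0" for \<tau>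
  proof -
    have "measure lebesgue (gain C (apex s \<tau>)) \<le> measure lebesgue (frame_map \<tau> ` winged_tent U U' s)"
      using sub[OF \<tau>] gain_measurable[OF convex conic] measure_frame_map_image(1)[OF lm] \<tau>
      by (intro measure_mono_fmeasurable) auto
    also have "\<dots> = \<tau> * measure lebesgue (winged_tent U U' s)" using measure_frame_map_image(2)[OF lm] \<tau> by simp
    also have "\<dots> \<le> \<tau> * c" using \<tau> k by (simp add: U'_def)
    finally show ?thesis .
  qed
  then show ?thesis using \<open>0 < \<tau>\<^sub>0\<close> by blast
qed

text \<open>The contraction by \<open>\<rho>\<close> makes room for the height of the tent, so that the part of the
  cylinder that is used is contained in the ball. Points of height \<open>0\<close> belong to the cone
  and have to be left out.\<close>

lemma tent_subset_gain:
  assumes \<rho>: "0 < \<rho>" and \<tau>: "0 < \<tau>" "\<rho>\<^sup>2 * (1 + \<tau>\<^sup>2) \<le> 1"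
  shows "frame_map \<tau> ` ((*\<^sub>R) \<rho> ` (tent U 0 - {v. v$3 = 0})) \<subseteq> gain C (apex 0 \<tau>)"
proof
  fix y assume "y \<in> frame_map \<tau> ` ((*\<^sub>R) \<rho> ` (tent U 0 - {v. v$3 = 0}))"
  then obtain v where v: "v \<in> tent U 0" "v$3 \<noteq> 0" and y_def: "y = frame_map \<tau> (\<rho> *\<^sub>R v)"
    by blast
  have y: "e \<bullet> y = \<rho> * v$1" "m \<bullet> y = \<rho> * v$2" "n \<bullet> y = \<tau> * \<rho> * v$3"
    by (simp_all add: y_def frame_map_def inner_add_right frame_inner orth)
  have v3: "0 < v$3" and cyl: "(v$1)\<^sup>2 + (v$2)\<^sup>2 \<le> 1" and le: "\<bar>v$1\<bar> \<le> U * (v$2 - v$3)"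
    using v by (auto simp: tent_def)
  have "y \<notin> C" using below[of y] y(3) v3 \<rho> \<tau> by (auto simp: mult_le_0_iff)
  have "v$3 \<le> 1" 
  proof -
    have "0 \<le> U * (v$2 - v$3)" using le by linarith
    then show ?thesis using U_pos abs_coordinates_le_1[OF cyl] by (auto simp: zero_le_mult_iff)
  qed
  then have "(v$3)\<^sup>2 \<le> 1" using v3 by (simp add: power_le_one)
  then have "\<tau>\<^sup>2 * (v$3)\<^sup>2 \<le> \<tau>\<^sup>2 * 1" by (intro mult_left_mono) auto
  then have "\<rho>\<^sup>2 * ((v$1)\<^sup>2 + (v$2)\<^sup>2 + \<tau>\<^sup>2 * (v$3)\<^sup>2) \<le> \<rho>\<^sup>2 * (1 + \<tau>\<^sup>2)"
    using cyl by (intro mult_left_mono) auto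
  then have "(norm y)\<^sup>2 \<le> 1" using \<tau> by (simp add: frame_norm y power_mult_distrib algebra_simps)
  then have "y \<in> cball 0 1" by (simp add: abs_square_le_1)
  define d where "d = (\<rho> * v$1) *\<^sub>R e + (\<rho> * (v$2 - v$3)) *\<^sub>R m"
  have d: "e \<bullet> d = \<rho> * v$1" "m \<bullet> d = \<rho> * (v$2 - v$3)" "n \<bullet> d = 0"
    by (simp_all add: d_def inner_add_right frame_inner orth)
  have "\<rho> * \<bar>v$1\<bar> \<le> \<rho> * (U * (v$2 - v$3))" using le \<rho> by simp
  then have "d \<in> C" using facet[OF d(3)] \<rho> by (simp add: d abs_mult mult.left_commute)
  moreover have "y = d + (\<rho> * v$3) *\<^sub>R apex 0 \<tau>"
    by (simp add: y_def d_def frame_map_def apex_def algebra_simps)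
  ultimately have "y \<in> cone_with C (apex 0 \<tau>)" using \<rho> v3 unfolding cone_with_def by fastforce
  then show "y \<in> gain C (apex 0 \<tau>)" using \<open>y \<notin> C\<close> \<open>y \<in> cball 0 1\<close> by (simp add: gain_def)
qed

lemma gain_volume_lower:
  assumes c: "0 \<le> c" "c < measure lebesgue (tent U 0)"
  shows "\<exists>\<tau>\<^sub>0>0. \<forall>\<tau>. 0 < \<tau> \<longrightarrow> \<tau> < \<tau>\<^sub>0 \<longrightarrow> \<tau> * c < measure lebesgue (gain C (apex 0 \<tau>))"
proof -
  define V where "V = measure lebesgue (tent U 0)"
  \<comment> \<open>The contraction that reduces the volume \<open>V\<close> of the tent to the mean of \<open>c\<close> and \<open>V\<close>.\<close>
  define \<rho> where "\<rho> = root 3 ((c + V) / (2 * V))"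
  have V: "0 < V" "c < V" using c by (auto simp: V_def)
  have "0 < (c + V) / (2 * V)" "(c + V) / (2 * V) < 1" using c V by (simp_all add: divide_simps)
  then have \<rho>: "0 < \<rho>" "\<rho> < 1" "\<rho> ^ 3 = (c + V) / (2 * V)" unfolding \<rho>_def by simp_all
  then have \<rho>V: "c < \<rho> ^ 3 * V" using V by (simp add: field_simps)
  define \<tau>\<^sub>0 where "\<tau>\<^sub>0 = sqrt (1 / \<rho>\<^sup>2 - 1)"
  have \<rho>2: "0 < \<rho>\<^sup>2" "\<rho>\<^sup>2 < 1" using \<rho> by (simp_all add: power_less_one_iff)
  then have "1 < 1 / \<rho>\<^sup>2" by simp
  then have \<tau>\<^sub>0: "0 < \<tau>\<^sub>0" "\<tau>\<^sub>0\<^sup>2 = 1 / \<rho>\<^sup>2 - 1" by (simp_all add: \<tau>\<^sub>0_def)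
  define T where "T = tent U 0 - {v. v$3 = 0}"
  have tent: "tent U 0 \<in> lmeasurable" using tent_measurable U_pos by simp
  have neg: "negligible {v :: real ^ 3. v$3 = 0}" by (rule negligible_standard_hyperplane_cart)
  have T: "T \<in> lmeasurable" unfolding T_def
    using tent negligible_imp_measurable[OF neg] by (rule fmeasurable.Diff)
  have mT: "measure lebesgue T = V" unfolding T_def V_def
    using neg tent by (intro measure_Diff_null_set) (auto simp: negligible_iff_null_sets)
  have lin: "linear ((*\<^sub>R) \<rho> :: real ^ 3 \<Rightarrow> real ^ 3)" by (simp add: linear_scaleR)
  have "\<tau> * c < measure lebesgue (gain C (apex 0 \<tau>))" if \<tau>: "0 < \<tau>" "\<tau> < \<tau>\<^sub>0" for \<tau>
  proof -
    have "\<tau>\<^sup>2 \<le> \<tau>\<^sub>0\<^sup>2" using \<tau> by (intro power_mono) auto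
    then have "\<rho>\<^sup>2 * (1 + \<tau>\<^sup>2) \<le> \<rho>\<^sup>2 * (1 + \<tau>\<^sub>0\<^sup>2)" by (intro mult_left_mono) auto
    also have "\<dots> = 1" using \<rho> by (simp add: \<tau>\<^sub>0)
    finally have sub: "frame_map \<tau> ` ((*\<^sub>R) \<rho> ` T) \<subseteq> gain C (apex 0 \<tau>)"
      using tent_subset_gain \<rho> \<tau> by (simp add: T_def)
    have det: "det (matrix ((*\<^sub>R) \<rho> :: real ^ 3 \<Rightarrow> real ^ 3)) = \<rho> ^ 3"
      by (simp add: matrix_def det_3 axis_def power3_eq_cube)
    have 1: "(*\<^sub>R) \<rho> ` T \<in> lmeasurable" "measure lebesgue ((*\<^sub>R) \<rho> ` T) = \<rho> ^ 3 * V"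
      using measurable_linear_image[OF lin T] measure_linear_image[OF lin T] mT \<rho>(1) by (simp_all add: det)
    have "\<tau> * c < \<tau> * (\<rho> ^ 3 * V)" using \<rho>V \<tau> by simp
    also have "\<dots> = measure lebesgue (frame_map \<tau> ` ((*\<^sub>R) \<rho> ` T))"
      using measure_frame_map_image(2)[OF 1(1), of \<tau>] \<tau> 1(2) by simp
    also have "\<dots> \<le> measure lebesgue (gain C (apex 0 \<tau>))"
      using sub gain_measurable[OF convex conic] measure_frame_map_image(1)[OF 1(1), of \<tau>] \<tau>
      by (intro measure_mono_fmeasurable) auto
    finally show ?thesis .
  qed
  then show ?thesis using \<open>0 < \<tau>\<^sub>0\<close> by blast
qed

end

section \<open>Geodesic convexity and convex cones\<close>

text \<open>Turns geodesic convexity into a statement on nonnegative linear combinations. With the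
  orthonormal pair \<open>p, v\<close> of the great circle through \<open>p\<close> and \<open>q\<close> the combination is at
  angle \<open>arccos a\<close> from \<open>p\<close>, and the claim is that this is at most the angle \<open>arccos c\<close> from
  \<open>p\<close> to \<open>q\<close>.\<close>

lemma geodesically_convex_combination:
  assumes T: "geodesically_convex T" and p: "p \<in> T" and q: "q \<in> T" and "p \<noteq> - q"
    and \<alpha>: "0 \<le> \<alpha>" and \<beta>: "0 \<le> \<beta>" and y: "norm (\<alpha> *\<^sub>R p + \<beta> *\<^sub>R q) = 1"
  shows "\<alpha> *\<^sub>R p + \<beta> *\<^sub>R q \<in> T"
proof -
  have "T \<subseteq> S2" using T by (simp add: geodesically_convex_def)
  then have np: "norm p = 1" and nq: "norm q = 1" using p q by auto
  show ?thesis
  proof (cases "p = q")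
    case True
    then have "\<alpha> *\<^sub>R p + \<beta> *\<^sub>R q = (\<alpha> + \<beta>) *\<^sub>R p" by (simp add: scaleR_left_distrib)
    moreover have "\<alpha> + \<beta> = 1" using y np \<alpha> \<beta> calculation by simp
    ultimately show ?thesis using p by simp
  next
    case False
    define c where "c = p \<bullet> q"
    have pp: "p \<bullet> p = 1" "q \<bullet> q = 1" "p \<bullet> q = c" "q \<bullet> p = c" using np nq by (simp_all add: norm_eq_1 c_def inner_commute)
    have "c \<le> 1" using Cauchy_Schwarz_ineq2[of p q] np nq by (simp add: c_def)
    have "\<bar>c\<bar> < 1"
    proof -
      have "0 < (p - q) \<bullet> (p - q)" "0 < (p + q) \<bullet> (p + q)"
        using False \<open>p \<noteq> - q\<close> by (simp_all add: eq_neg_iff_add_eq_0)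
      then show ?thesis by (simp add: inner_diff_left inner_diff_right inner_add_left inner_add_right pp)
    qed
    define \<sigma> where "\<sigma> = sqrt (1 - c\<^sup>2)"
    have c2: "c\<^sup>2 < 1" using \<open>\<bar>c\<bar> < 1\<close> by (simp add: abs_square_less_1)
    have \<sigma>: "0 < \<sigma>" "\<sigma>\<^sup>2 = 1 - c\<^sup>2" using c2 by (simp_all add: \<sigma>_def)
    define v where "v = (q - c *\<^sub>R p) /\<^sub>R \<sigma>"
    have q_eq: "q = c *\<^sub>R p + \<sigma> *\<^sub>R v" using \<sigma> by (simp add: v_def)
    have "v \<bullet> v = (1 - c\<^sup>2) / \<sigma>\<^sup>2"
      by (simp add: v_def inner_diff_left inner_diff_right pp power2_eq_square divide_simps)
    then have vv: "norm v = 1" using \<sigma> c2 by (simp add: norm_eq_1)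
    have pv: "p \<bullet> v = 0" by (simp add: v_def inner_diff_right pp)
    have on: "orthonormal_pair p v" using np vv pv by (simp add: orthonormal_pair_def)
    define l where "l = arccos c"
    have l: "0 \<le> l" "l < pi" "cos l = c" "sin l = \<sigma>"
      using \<open>\<bar>c\<bar> < 1\<close> arccos_lt_bounded[of c] unfolding l_def
      by (simp_all add: sin_arccos \<sigma>_def abs_less_iff less_imp_le)
    define a where "a = \<alpha> + \<beta> * c"
    define b where "b = \<beta> * \<sigma>"
    have comb: "\<alpha> *\<^sub>R p + \<beta> *\<^sub>R q = a *\<^sub>R p + b *\<^sub>R v" by (simp add: q_eq a_def b_def algebra_simps)
    have "(a *\<^sub>R p + b *\<^sub>R v) \<bullet> (a *\<^sub>R p + b *\<^sub>R v) = 1" using y by (simp add: comb norm_eq_1)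
    then have ab: "a\<^sup>2 + b\<^sup>2 = 1"
      using vv pv by (simp add: inner_add_left inner_add_right pp inner_commute[of v p] norm_eq_1 power2_eq_square)
    have b0: "0 \<le> b" using \<beta> \<sigma> by (simp add: b_def)
    have a1: "\<bar>a\<bar> \<le> 1" using abs_coordinates_le_1[of a b] ab by simp
    have sum1: "1 \<le> \<alpha> + \<beta>" using norm_triangle_ineq[of "\<alpha> *\<^sub>R p" "\<beta> *\<^sub>R q"] y np nq \<alpha> \<beta> by simp
    \<comment> \<open>The combination is at most as far from \<open>p\<close> as \<open>q\<close>: for an acute angle by the triangle inequality \<open>sum1\<close>; for an obtuse one and \<open>\<beta> > 1\<close> because its component orthogonal to \<open>p\<close> exceeds that of \<open>q\<close>.\<close>
    have ca: "c \<le> a"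
    proof (cases "0 \<le> c")
      case True
      have "c * 1 \<le> c * (\<alpha> + \<beta>)" using True sum1 by (intro mult_left_mono)
      moreover have "c * \<alpha> \<le> 1 * \<alpha>" using \<open>c \<le> 1\<close> \<alpha> by (intro mult_right_mono)
      ultimately show ?thesis by (simp add: a_def algebra_simps)
    next
      case False
      show ?thesis
      proof (cases "\<beta> \<le> 1")
        case True
        then have "1 * c \<le> \<beta> * c" using False by (intro mult_right_mono_neg) auto
        then show ?thesis using \<alpha> by (simp add: a_def)
      next
        case False
        have "1 * \<sigma>\<^sup>2 \<le> \<beta>\<^sup>2 * \<sigma>\<^sup>2" using False by (intro mult_right_mono) (auto simp: one_le_power)
        then have "a\<^sup>2 \<le> c\<^sup>2" using ab \<sigma>(2) by (simp add: b_def power_mult_distrib)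
        then have "\<bar>a\<bar> \<le> \<bar>c\<bar>" by (simp add: abs_le_square_iff)
        then show ?thesis using \<open>\<not> 0 \<le> c\<close> by linarith
      qed
    qed
    define \<theta> where "\<theta> = arccos a"
    have "cos \<theta> = a" using a1 by (simp add: \<theta>_def)
    moreover have "1 - a\<^sup>2 = b\<^sup>2" using ab by simp
    then have "sin \<theta> = b" using a1 b0 by (simp add: \<theta>_def sin_arccos abs_le_iff)
    moreover have "\<theta> \<in> {0..l}" using a1 ca \<open>\<bar>c\<bar> < 1\<close> arccos_lbound[of a] 
      by (auto simp: \<theta>_def l_def intro!: arccos_le_arccos)
    moreover have "great_circle p v 0 \<in> T" "great_circle p v l \<in> T"
      using p q by (simp_all add: great_circle_def l flip: q_eq)
    then have "great_circle p v ` {0..l} \<subseteq> T" 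
      using T on l unfolding geodesically_convex_def by blast
    ultimately show ?thesis unfolding comb by (auto simp: great_circle_def)
  qed
qed

lemma norm_great_circle:
  assumes "orthonormal_pair u v"
  shows "norm (great_circle u v t) = 1"
proof -
  have "great_circle u v t \<bullet> great_circle u v t = (cos t)\<^sup>2 + (sin t)\<^sup>2"
    using assms by (simp add: great_circle_def orthonormal_pair_def inner_add_left inner_add_right norm_eq_1 
        inner_commute[of v u] power2_eq_square)
  then show ?thesis by (simp add: norm_eq_1)
qed

text \<open>A point of an arc shorter than \<open>\<pi>\<close> is a nonnegative combination of the endpoints, with
  the coefficients of spherical linear interpolation.\<close>

lemma geodesically_convex_cone_section:
  assumes "convex Z" "conic Z"
  shows "geodesically_convex (Z \<inter> S2)"
  unfolding geodesically_convex_def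
proof (intro conjI allI impI subsetI)
  fix u v and l :: real and x
  assume on: "orthonormal_pair u v" and l: "0 \<le> l" "l < pi" 
    and u: "great_circle u v 0 \<in> Z \<inter> S2" and gl: "great_circle u v l \<in> Z \<inter> S2" 
    and "x \<in> great_circle u v ` {0..l}"
  then obtain t where t: "0 \<le> t" "t \<le> l" "x = great_circle u v t" by auto
  show "x \<in> Z \<inter> S2"
  proof (cases "l = 0")
    case True then show ?thesis using t u by simp
  next
    case False
    then have s: "0 < sin l" using l by (intro sin_gt_zero) auto
    have "sin l * cos t = sin (l - t) + sin t * cos l" by (simp add: sin_diff algebra_simps)
    then have "sin l *\<^sub>R x = sin (l - t) *\<^sub>R great_circle u v 0 + sin t *\<^sub>R great_circle u v l"
      by (simp add: t great_circle_def algebra_simps flip: scaleR_left_distrib)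
    then have x: "x = (sin (l - t) / sin l) *\<^sub>R great_circle u v 0 + (sin t / sin l) *\<^sub>R great_circle u v l"
      using s by (metis (no_types, lifting) divide_inverse_commute scaleR_right_distrib scaleR_scaleR
          left_inverse less_irrefl scaleR_one)
    have "0 \<le> sin (l - t)" "0 \<le> sin t" using t l by (auto intro: sin_ge_zero)
    then have "x \<in> Z" unfolding x using u gl s assms
      by (intro convex_conic_add conic_mul) auto
    then show ?thesis using norm_great_circle[OF on] t by simp
  qed
qed auto

lemma convex_conic_hull_geodesic:
  assumes K: "geodesically_convex K" and w: "\<And>x. x \<in> K \<Longrightarrow> 0 < w \<bullet> x"
  shows "convex (conic hull K)"
proof (rule convexI)
  fix a b :: "real ^ 3" and \<alpha> \<beta> :: real
  assume "a \<in> conic hull K" "b \<in> conic hull K" and uv: "0 \<le> \<alpha>" "0 \<le> \<beta>" "\<alpha> + \<beta> = 1"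
  then obtain r k t j where a: "a = r *\<^sub>R k" "0 \<le> r" "k \<in> K" and b: "b = t *\<^sub>R j" "0 \<le> t" "j \<in> K"
    by (auto simp: conic_hull_explicit)
  define y where "y = \<alpha> *\<^sub>R a + \<beta> *\<^sub>R b"
  have "y \<in> conic hull K"
  proof (cases "y = 0")
    case True
    have "0 = 0 *\<^sub>R k" by simp
    then show ?thesis using a True unfolding conic_hull_explicit by blast
  next
    case False
    let ?z = "(\<alpha> * r / norm y) *\<^sub>R k + (\<beta> * t / norm y) *\<^sub>R j"
    have z: "?z = y /\<^sub>R norm y" by (simp add: y_def a b algebra_simps divide_inverse)
    have "k \<noteq> - j" using w[OF a(3)] w[OF b(3)] by auto
    then have "?z \<in> K" using K a b uv False z
      by (intro geodesically_convex_combination) auto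
    moreover have "y = norm y *\<^sub>R ?z" using False by (simp add: z)
    ultimately show ?thesis unfolding conic_hull_explicit by fastforce
  qed
  then show "\<alpha> *\<^sub>R a + \<beta> *\<^sub>R b \<in> conic hull K" by (simp add: y_def)
qed

lemma conic_hull_Int_S2:
  assumes "K \<subseteq> S2"
  shows "conic hull K \<inter> S2 = K"
proof
  show "K \<subseteq> conic hull K \<inter> S2" using assms by (auto intro: hull_inc)
  show "conic hull K \<inter> S2 \<subseteq> K"
  proof
    fix y assume y: "y \<in> conic hull K \<inter> S2"
    then obtain r k where k: "y = r *\<^sub>R k" "0 \<le> r" "k \<in> K" by (auto simp: conic_hull_explicit)
    then have "r = 1" using y assms by auto
    then show "y \<in> K" using k by simp
  qed
qed

text \<open>Every unit vector \<open>r k + t x\<close> of the extended cone lies on the geodesic from \<open>k\<close> to the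
  direction of \<open>x\<close>. The condition on \<open>- x\<close> excludes antipodal pairs, which geodesic convexity
  says nothing about.\<close>

lemma geodesic_join_eq_cone_section:
  assumes K: "geodesically_convex K" "K \<noteq> {}" and C: "convex (conic hull K)"
    and x: "x \<noteq> 0" "- x \<notin> conic hull K"
  shows "geodesic_join (x /\<^sub>R norm x) K = cone_with (conic hull K) x \<inter> S2"
proof
  let ?C = "conic hull K"
  have 0: "0 \<in> ?C" using K by (simp add: conic_contains_0 conic_conic_hull conic_hull_eq_empty)
  have KS: "K \<subseteq> S2" using K by (simp add: geodesically_convex_def)
  show "geodesic_join (x /\<^sub>R norm x) K \<subseteq> cone_with ?C x \<inter> S2"
    unfolding geodesic_join_def
  proof (rule hull_minimal)
    show "geodesically_convex (cone_with ?C x \<inter> S2)"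
      by (intro geodesically_convex_cone_section convex_cone_with conic_cone_with C conic_conic_hull)
    have "c \<in> cone_with ?C x" if "c \<in> ?C" for c
      unfolding cone_with_def using that by (intro CollectI exI[of _ c] exI[of _ 0]) auto
    then have "K \<subseteq> cone_with ?C x" by (auto intro: hull_inc)
    moreover have "x /\<^sub>R norm x \<in> cone_with ?C x"
      unfolding cone_with_def using 0 by (intro CollectI exI[of _ 0] exI[of _ "inverse (norm x)"]) auto
    ultimately show "{x /\<^sub>R norm x} \<union> K \<subseteq> cone_with ?C x \<inter> S2" using KS x by auto
  qed
  show "cone_with ?C x \<inter> S2 \<subseteq> geodesic_join (x /\<^sub>R norm x) K"
    unfolding geodesic_join_def hull_def[of geodesically_convex]
  proof (intro subsetI InterI)
    fix y T assume y: "y \<in> cone_with ?C x \<inter> S2" and T: "T \<in> {T. geodesically_convex T \<and> {x /\<^sub>R norm x} \<union> K \<subseteq> T}"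
    then obtain r k t where k: "y = r *\<^sub>R k + t *\<^sub>R x" "0 \<le> r" "0 \<le> t" "k \<in> K"
      by (auto simp: cone_with_def conic_hull_explicit)
    have y': "y = r *\<^sub>R k + (t * norm x) *\<^sub>R (x /\<^sub>R norm x)" using x k by simp
    have "k \<noteq> - (x /\<^sub>R norm x)"
    proof
      assume "k = - (x /\<^sub>R norm x)"
      then have "- x = norm x *\<^sub>R k" using x by simp
      then show False using x k(4) unfolding conic_hull_explicit by (metis (mono_tags, lifting) mem_Collect_eq norm_ge_zero)
    qed
    moreover have "geodesically_convex T" "k \<in> T" "x /\<^sub>R norm x \<in> T" using T k(4) by auto
    moreover have "norm y = 1" using y by simp
    moreover have "0 \<le> t * norm x" using k(3) by simp
    ultimately show "y \<in> T"
      using geodesically_convex_combination[of T k "x /\<^sub>R norm x" r "t * norm x"] k(2)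
      unfolding y' by blast
  qed
qed

text \<open>The sector over the added part of the sphere and the solid \<open>gain\<close> differ at most in the
  origin.\<close>

lemma spherical_area_gain:
  assumes K: "geodesically_convex K" "K \<noteq> {}" and C: "convex (conic hull K)"
    and x: "x \<noteq> 0" "- x \<notin> conic hull K"
  shows "spherical_area (geodesic_join (x /\<^sub>R norm x) K - K) = 3 * measure lebesgue (gain (conic hull K) x)"
proof -
  let ?C = "conic hull K" and ?G = "gain (conic hull K) x"
  define A where "A = geodesic_join (x /\<^sub>R norm x) K - K"
  have KS: "K \<subseteq> S2" using K by (simp add: geodesically_convex_def)
  have 0: "0 \<in> ?C" using K by (simp add: conic_contains_0 conic_conic_hull conic_hull_eq_empty)
  have A: "a \<in> A \<longleftrightarrow> norm a = 1 \<and> a \<in> cone_with ?C x \<and> a \<notin> ?C" for a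
  proof -
    have "a \<in> K \<longleftrightarrow> a \<in> ?C \<and> norm a = 1" using conic_hull_Int_S2[OF KS] by (metis Int_iff mem_sphere_0)
    then show ?thesis unfolding A_def geodesic_join_eq_cone_section[OF assms] Diff_iff Int_iff mem_sphere_0 by blast
  qed
  have scale: "r *\<^sub>R y \<in> cone_with ?C x - ?C" if y: "y \<in> cone_with ?C x - ?C" and r: "0 < r" for r y
  proof -
    have "r *\<^sub>R y \<in> cone_with ?C x" 
      using y r conic_cone_with[OF conic_conic_hull] by (intro conic_mul) auto
    moreover have "y \<in> ?C" if "r *\<^sub>R y \<in> ?C"
      using conic_mul[OF conic_conic_hull that, of "inverse r"] r by simp
    ultimately show ?thesis using y by blast
  qed
  have "sector A - ?G \<subseteq> {0}"
  proof
    fix y assume y: "y \<in> sector A - ?G"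
    then obtain r a where ra: "y = r *\<^sub>R a" "0 \<le> r" "r \<le> 1" "a \<in> A" by (auto simp: sector_def)
    have "r = 0"
    proof (rule ccontr)
      assume "r \<noteq> 0"
      then have "y \<in> ?G" using scale[of a r] ra by (auto simp: gain_def A)
      then show False using y by blast
    qed
    then show "y \<in> {0}" by (simp add: ra)
  qed
  moreover have "?G \<subseteq> sector A"
  proof
    fix y assume y: "y \<in> ?G"
    then have "y \<noteq> 0" using 0 by (auto simp: gain_def)
    then have "y /\<^sub>R norm y \<in> A" using scale[of y "inverse (norm y)"] y by (auto simp: gain_def A)
    moreover have "y = norm y *\<^sub>R (y /\<^sub>R norm y)" "norm y \<le> 1" using \<open>y \<noteq> 0\<close> y by (simp_all add: gain_def)
    ultimately show "y \<in> sector A" unfolding sector_def 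
      by (intro CollectI exI[of _ "norm y"] exI[of _ "y /\<^sub>R norm y"]) auto
  qed
  ultimately have "(?G - sector A) \<union> (sector A - ?G) \<subseteq> {0}" by blast
  then have "negligible ((?G - sector A) \<union> (sector A - ?G))"
    using negligible_subset[OF negligible_sing] by blast
  then have "measure lebesgue (sector A) = measure lebesgue ?G"
    using measure_negligible_symdiff[OF gain_measurable[OF C conic_conic_hull]] by blast
  then show ?thesis by (simp add: spherical_area_def A_def)
qed

section \<open>The facet spanned by a boundary segment\<close>

text \<open>Support the cone at an inner point \<open>g h\<close> of the boundary arc. The neighbouring points
  \<open>g 0\<close> and \<open>g (2 * h)\<close> are on the same side of the supporting plane, and their sum is a
  multiple of \<open>g h\<close>, so that they are on the plane as well; hence the plane contains the
  entire great circle.\<close>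

lemma supporting_plane_of_boundary_segment:
  assumes K: "compact K" "geodesically_convex K" and C: "convex (conic hull K)"
    and A: "geodesic_segment A" "A \<subseteq> sphere_boundary K"
  obtains u v n h where "orthonormal_frame u v n" "\<And>y. y \<in> conic hull K \<Longrightarrow> n \<bullet> y \<le> 0"
    "u \<in> K" "great_circle u v h \<in> K" "0 < h" "h < pi"
proof -
  let ?C = "conic hull K"
  obtain u v l where on: "orthonormal_pair u v" and l: "0 < l" and A_eq: "A = great_circle u v ` {0..l}"
    using A(1) unfolding geodesic_segment_def by blast
  define g where "g = great_circle u v"
  \<comment> \<open>The bound \<open>1\<close> keeps \<open>h\<close> below \<open>\<pi>\<close>, so that \<open>u\<close> and \<open>g h\<close> are linearly independent.\<close>
  define h where "h = min (l / 2) 1"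
  have h: "0 < h" "2 * h \<le> l" "h \<le> 1" using l by (auto simp: h_def)
  have KS: "K \<subseteq> S2" using K by (simp add: geodesically_convex_def)
  have "closed K" using K compact_imp_closed by blast
  have "closedin (top_of_set S2) K" using KS \<open>closed K\<close> by (simp add: closed_subset)
  then have "sphere_boundary K \<subseteq> K" 
    unfolding sphere_boundary_def using frontier_of_subset_closedin by blast
  moreover have gA: "g t \<in> sphere_boundary K" if "t \<in> {0, h, 2 * h}" for t
  proof -
    have "t \<in> {0..l}" using that h by auto
    then show ?thesis using A(2) unfolding A_eq g_def by blast
  qed
  ultimately have gK: "g 0 \<in> K" "g h \<in> K" "g (2 * h) \<in> K" by blast+
  have gC: "g 0 \<in> ?C" "g h \<in> ?C" "g (2 * h) \<in> ?C" using gK by (simp_all add: hull_inc)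
  have 0: "0 \<in> ?C" using gK by (auto simp: conic_contains_0 conic_conic_hull conic_hull_eq_empty)
  have notint: "g h \<notin> interior ?C"
  proof
    assume i: "g h \<in> interior ?C"
    have "openin (top_of_set S2) (S2 \<inter> interior ?C)" by blast
    moreover have "S2 \<inter> interior ?C \<subseteq> ?C \<inter> S2" using interior_subset[of ?C] by auto
    then have "S2 \<inter> interior ?C \<subseteq> K" by (simp only: conic_hull_Int_S2[OF KS])
    ultimately have "S2 \<inter> interior ?C \<subseteq> top_of_set S2 interior_of K" by (intro interior_of_maximal)
    then have "g h \<in> top_of_set S2 interior_of K" using i gK KS by blast
    then show False using gA[of h] by (simp add: sphere_boundary_def frontier_of_def)
  qed
  obtain a where a: "a \<noteq> 0" "\<And>y. y \<in> ?C \<Longrightarrow> a \<bullet> g h \<le> a \<bullet> y"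
  proof (cases "interior ?C = {}")
    case True
    then obtain a b where ab: "a \<noteq> 0" "?C \<subseteq> {y. a \<bullet> y = b}" using empty_interior_subset_hyperplane[OF C] by blast
    then have "a \<bullet> y = b" if "y \<in> ?C" for y using that by blast
    then have "a \<bullet> g h \<le> a \<bullet> y" if "y \<in> ?C" for y using that gC(2) by simp
    then show ?thesis using that[of a] ab(1) by blast
  next
    case False
    then have "g h \<notin> rel_interior ?C" using notint rel_interior_nonempty_interior by metis
    show ?thesis
    proof (rule supporting_hyperplane_rel_boundary[OF C gC(2) \<open>g h \<notin> rel_interior ?C\<close>])
      fix a assume "a \<noteq> 0" "\<And>y. y \<in> ?C \<Longrightarrow> a \<bullet> g h \<le> a \<bullet> y"
      then show ?thesis by (rule that)
    qed
  qed
  have "a \<bullet> g h \<le> 0" using a(2)[OF 0] by simp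
  moreover have "a \<bullet> g h \<le> 2 * (a \<bullet> g h)" using a(2)[of "2 *\<^sub>R g h"] conic_mul[OF conic_conic_hull gC(2), of 2] by simp
  ultimately have agh: "a \<bullet> g h = 0" by linarith
  define n where "n = - (a /\<^sub>R norm a)"
  have n: "norm n = 1" using a by (simp add: n_def)
  have below: "n \<bullet> y \<le> 0" if "y \<in> ?C" for y
    using a(2)[OF that] agh by (simp add: n_def)
  have ngh: "n \<bullet> g h = 0" using agh by (simp add: n_def)
  have "g 0 + g (2 * h) = (1 + cos (2 * h)) *\<^sub>R u + sin (2 * h) *\<^sub>R v"
    by (simp add: g_def great_circle_def scaleR_left_distrib)
  moreover have "1 + cos (2 * h) = 2 * cos h * cos h" by (simp add: cos_double_cos power2_eq_square)
  moreover have "sin (2 * h) = 2 * cos h * sin h" by (simp add: sin_double)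
  ultimately have "g 0 + g (2 * h) = (2 * cos h) *\<^sub>R g h"
    by (simp add: g_def great_circle_def scaleR_right_distrib)
  then have "n \<bullet> g 0 + n \<bullet> g (2 * h) = 0" using ngh by (metis inner_add_right inner_scaleR_right mult_zero_right)
  then have ng: "n \<bullet> g 0 = 0" using below[OF gC(1)] below[OF gC(3)] by linarith
  have nu: "n \<bullet> u = 0" using ng by (simp add: g_def great_circle_def)
  have "h < pi" using h pi_gt3 by linarith
  then have "0 < sin h" using h sin_gt_zero by blast
  moreover have "sin h * (n \<bullet> v) = 0" using ngh nu by (simp add: g_def great_circle_def inner_add_right)
  ultimately have nv: "n \<bullet> v = 0" by simp
  have "orthonormal_frame u v n"
    using on n nu nv by unfold_locales (simp_all add: orthonormal_pair_def inner_commute[of _ n])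
  moreover have "u \<in> K" using gK(1) by (simp add: g_def great_circle_def)
  ultimately show ?thesis using that[of u v n h] below gK(2) h \<open>h < pi\<close> by (simp add: g_def)
qed

text \<open>The facet is a planar cone in an open half-plane, hence spanned by two extreme rays. They
  are found by maximising and minimising the slope \<open>\<phi> = f / w\<close> over the compact set \<open>F\<close> of
  unit vectors of the facet, where \<open>f\<close> and the functional \<open>w\<close>, positive on \<open>K\<close>, form
  linear coordinates of the plane. For unit vectors \<open>a\<close>, \<open>b\<close> the vectors \<open>a + b\<close> and
  \<open>a - b\<close> are orthogonal; they give the bisector \<open>m\<close> and the direction \<open>e\<close>.\<close>

lemma facet_cone_of_supporting_plane:
  assumes K: "compact K" "geodesically_convex K" and w: "\<And>x. x \<in> K \<Longrightarrow> 0 < w \<bullet> x"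
    and frame: "orthonormal_frame u v n" and below: "\<And>y. y \<in> conic hull K \<Longrightarrow> n \<bullet> y \<le> 0"
    and p: "u \<in> K" "great_circle u v h \<in> K" "0 < h" "h < pi"
  obtains e m U where "facet_cone e m n (conic hull K) U"
proof -
  let ?C = "conic hull K"
  interpret uv: orthonormal_frame u v n by (rule frame)
  have KS: "K \<subseteq> S2" using K by (simp add: geodesically_convex_def)
  have convex: "convex ?C" using K(2) w by (rule convex_conic_hull_geodesic)
  have "0 \<notin> K" using w[of 0] by auto
  then have closed: "closed ?C" using K by (intro closed_conic_hull_strong) simp
  \<comment> \<open>The inner product with the projection of \<open>w\<close> to the plane, turned by a right angle.\<close>
  define f where "f y = (w \<bullet> v) * (u \<bullet> y) - (w \<bullet> u) * (v \<bullet> y)" for y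
  have wu: "0 < w \<bullet> u" using w p by blast
  have inj: "z = 0" if "n \<bullet> z = 0" "f z = 0" "w \<bullet> z = 0" for z
  proof -
    define x y where "x = u \<bullet> z" and "y = v \<bullet> z"
    have z: "z = x *\<^sub>R u + y *\<^sub>R v" using uv.frame_expansion[of z] that(1) by (simp add: x_def y_def)
    have 1: "(w \<bullet> v) * x = (w \<bullet> u) * y" using that(2) by (simp add: f_def x_def y_def)
    have 2: "x * (w \<bullet> u) + y * (w \<bullet> v) = 0" using that(3) by (simp add: z inner_add_right)
    have "x * ((w \<bullet> u)\<^sup>2 + (w \<bullet> v)\<^sup>2) = (w \<bullet> u) * (x * (w \<bullet> u) + y * (w \<bullet> v))
        + (w \<bullet> v) * ((w \<bullet> v) * x - (w \<bullet> u) * y)" by (simp add: power2_eq_square algebra_simps)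
    also have "\<dots> = 0" using 1 2 by simp
    finally have x0: "x = 0" using wu by (simp add: sum_power2_eq_zero_iff)
    then have "y = 0" using 1 wu by simp
    then show ?thesis using z x0 by simp
  qed
  define F where "F = K \<inter> {y. n \<bullet> y = 0}"
  have cF: "compact F" unfolding F_def using K by (intro compact_Int_closed closed_hyperplane)
  have u_F: "u \<in> F" and g_F: "great_circle u v h \<in> F"
    using p by (simp_all add: F_def uv.frame_inner great_circle_def inner_add_right)
  define \<phi> where "\<phi> y = f y / (w \<bullet> y)" for y
  have "continuous_on F \<phi>" unfolding \<phi>_def f_def using w by (intro continuous_intros) (force simp: F_def)
  then obtain a b where a: "a \<in> F" "\<And>y. y \<in> F \<Longrightarrow> \<phi> y \<le> \<phi> a" and b: "b \<in> F" "\<And>y. y \<in> F \<Longrightarrow> \<phi> b \<le> \<phi> y"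
    using continuous_attains_sup[OF cF] continuous_attains_inf[OF cF] u_F by (metis empty_iff)
  have f_lin: "f (x + y) = f x + f y" "f (r *\<^sub>R x) = r * f x" for x y r
    by (simp_all add: f_def inner_add_right algebra_simps)
  have wF: "0 < w \<bullet> y" "n \<bullet> y = 0" "norm y = 1" if "y \<in> F" for y using that w KS by (auto simp: F_def)
  have "\<phi> u \<noteq> \<phi> (great_circle u v h)"
  proof
    let ?g = "great_circle u v h"
    assume eq: "\<phi> u = \<phi> ?g"
    define z where "z = (w \<bullet> ?g) *\<^sub>R u + (- (w \<bullet> u)) *\<^sub>R ?g"
    have "f z = (w \<bullet> ?g) * f u + (- (w \<bullet> u)) * f ?g" unfolding z_def by (simp only: f_lin)
    then have "f z = 0" using eq wF(1)[OF u_F] wF(1)[OF g_F] by (simp add: \<phi>_def field_simps)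
    moreover have "n \<bullet> z = 0" "w \<bullet> z = 0" using wF(2)[OF u_F] wF(2)[OF g_F] by (simp_all add: z_def inner_diff_right)
    ultimately have "z = 0" using inj by blast
    then have "v \<bullet> z = 0" by simp
    then have "(w \<bullet> u) * sin h = 0" by (simp add: z_def great_circle_def inner_add_right inner_diff_right uv.frame_inner)
    then show False using wu sin_gt_zero[OF p(3,4)] by simp
  qed
  then have \<phi>_less: "\<phi> b < \<phi> a" using a(2) b(2) u_F g_F by (metis linorder_not_le order_antisym order_trans)
  have span: "\<exists>\<alpha> \<beta>. 0 \<le> \<alpha> \<and> 0 \<le> \<beta> \<and> y = \<alpha> *\<^sub>R a + \<beta> *\<^sub>R b" if y: "y \<in> F" for y
  proof -
    define \<mu> where "\<mu> = (\<phi> y - \<phi> b) / (\<phi> a - \<phi> b)"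
    have \<mu>: "0 \<le> \<mu>" "\<mu> \<le> 1" using a(2)[OF y] b(2)[OF y] \<phi>_less by (simp_all add: \<mu>_def)
    define \<alpha> where "\<alpha> = (w \<bullet> y) * \<mu> / (w \<bullet> a)"
    define \<beta> where "\<beta> = (w \<bullet> y) * (1 - \<mu>) / (w \<bullet> b)"
    have wa: "\<alpha> * (w \<bullet> a) = (w \<bullet> y) * \<mu>" "\<beta> * (w \<bullet> b) = (w \<bullet> y) * (1 - \<mu>)"
      using wF(1)[OF a(1)] wF(1)[OF b(1)] by (simp_all add: \<alpha>_def \<beta>_def)
    have fF: "f x = \<phi> x * (w \<bullet> x)" if "x \<in> F" for x using wF(1)[OF that] by (simp add: \<phi>_def)
    define z where "z = y + (- \<alpha>) *\<^sub>R a + (- \<beta>) *\<^sub>R b"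
    have "f z = f y - \<alpha> * f a - \<beta> * f b" unfolding z_def by (simp only: f_lin)
    also have "\<dots> = \<phi> y * (w \<bullet> y) - \<phi> a * (\<alpha> * (w \<bullet> a)) - \<phi> b * (\<beta> * (w \<bullet> b))"
      by (simp add: fF y a b)
    also have "\<dots> = (w \<bullet> y) * (\<phi> y - \<phi> b - \<mu> * (\<phi> a - \<phi> b))" unfolding wa by (simp add: algebra_simps)
    also have "\<mu> * (\<phi> a - \<phi> b) = \<phi> y - \<phi> b" using \<phi>_less by (simp add: \<mu>_def)
    finally have "f z = 0" by simp
    moreover have "n \<bullet> z = 0" using wF(2)[OF y] wF(2)[OF a(1)] wF(2)[OF b(1)] by (simp add: z_def inner_diff_right)
    moreover have "w \<bullet> z = 0" using wa by (simp add: z_def inner_diff_right algebra_simps)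
    ultimately have "z = 0" using inj by blast
    then have "y = \<alpha> *\<^sub>R a + \<beta> *\<^sub>R b" by (simp add: z_def algebra_simps)
    moreover have "0 \<le> \<alpha>" "0 \<le> \<beta>" using \<mu> wF(1)[OF y] wF(1)[OF a(1)] wF(1)[OF b(1)] by (simp_all add: \<alpha>_def \<beta>_def)
    ultimately show ?thesis by blast
  qed
  have "a \<noteq> b" using \<phi>_less by auto
  have "a \<noteq> - b" using wF(1)[OF a(1)] wF(1)[OF b(1)] by auto
  define M where "M = norm (a + b)"
  define E where "E = norm (a - b)"
  have ME: "0 < M" "0 < E" using \<open>a \<noteq> b\<close> \<open>a \<noteq> - b\<close> by (simp_all add: M_def E_def eq_neg_iff_add_eq_0)
  define m where "m = (a + b) /\<^sub>R M"
  define e where "e = (a - b) /\<^sub>R E"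
  have ab: "a = (M / 2) *\<^sub>R m + (E / 2) *\<^sub>R e" "b = (M / 2) *\<^sub>R m - (E / 2) *\<^sub>R e"
    using ME by (simp_all add: m_def e_def algebra_simps flip: scaleR_left_distrib)
  have "a \<bullet> a = 1" "b \<bullet> b = 1" using wF(3)[OF a(1)] wF(3)[OF b(1)] by (simp_all add: norm_eq_1)
  then have "(a - b) \<bullet> (a + b) = 0" by (simp add: inner_add_right inner_diff_left inner_commute[of b a])
  then have "e \<bullet> m = 0" by (simp only: e_def m_def inner_scaleR_left inner_scaleR_right mult_zero_right)
  then interpret fr: orthonormal_frame e m n
    using ME uv.unit wF(2)[OF a(1)] wF(2)[OF b(1)]
    by unfold_locales (simp_all add: m_def e_def M_def E_def inner_commute[of _ n] inner_add_right inner_diff_right)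
  define U where "U = E / M"
  have "facet_cone e m n ?C U"
  proof unfold_locales
    fix y assume ny: "n \<bullet> y = 0"
    show "y \<in> ?C \<longleftrightarrow> \<bar>e \<bullet> y\<bar> \<le> U * (m \<bullet> y)"
    proof
      assume "y \<in> ?C"
      then obtain r k where k: "y = r *\<^sub>R k" "0 \<le> r" "k \<in> K" by (auto simp: conic_hull_explicit)
      show "\<bar>e \<bullet> y\<bar> \<le> U * (m \<bullet> y)"
      proof (cases "r = 0")
        case False
        then have "k \<in> F" using k ny by (simp add: F_def)
        then obtain \<alpha> \<beta> where ab': "0 \<le> \<alpha>" "0 \<le> \<beta>" "k = \<alpha> *\<^sub>R a + \<beta> *\<^sub>R b" using span by blast
        have ek: "e \<bullet> k = (\<alpha> - \<beta>) * (E / 2)" "m \<bullet> k = (\<alpha> + \<beta>) * (M / 2)"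
          unfolding ab'(3) ab by (simp_all add: inner_add_right inner_diff_right fr.frame_inner fr.orth algebra_simps)
        have "\<bar>e \<bullet> k\<bar> = \<bar>\<alpha> - \<beta>\<bar> * (E / 2)" "U * (m \<bullet> k) = (\<alpha> + \<beta>) * (E / 2)"
          unfolding ek U_def using ME by (simp_all add: abs_mult)
        moreover have "\<bar>\<alpha> - \<beta>\<bar> * (E / 2) \<le> (\<alpha> + \<beta>) * (E / 2)" using ab' ME by (intro mult_right_mono) auto
        ultimately have "\<bar>e \<bullet> k\<bar> \<le> U * (m \<bullet> k)" by simp
        then have "r * \<bar>e \<bullet> k\<bar> \<le> r * (U * (m \<bullet> k))" using k by (intro mult_left_mono)
        then show ?thesis using k by (simp add: abs_mult mult.left_commute)
      qed (simp add: k)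
    next
      assume le: "\<bar>e \<bullet> y\<bar> \<le> U * (m \<bullet> y)"
      define \<alpha> where "\<alpha> = (m \<bullet> y) / M + (e \<bullet> y) / E"
      define \<beta> where "\<beta> = (m \<bullet> y) / M - (e \<bullet> y) / E"
      have "\<bar>e \<bullet> y\<bar> / E \<le> (m \<bullet> y) / M" using le ME by (simp add: U_def field_simps)
      then have "\<bar>(e \<bullet> y) / E\<bar> \<le> (m \<bullet> y) / M" using ME by simp
      then have "0 \<le> \<alpha>" "0 \<le> \<beta>" unfolding \<alpha>_def \<beta>_def by linarith+
      moreover have "a \<in> ?C" "b \<in> ?C" using a b by (auto simp: F_def intro: hull_inc)
      ultimately have "\<alpha> *\<^sub>R a + \<beta> *\<^sub>R b \<in> ?C"
        by (intro convex_conic_add convex conic_conic_hull conic_mul)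
      moreover have "\<alpha> *\<^sub>R a + \<beta> *\<^sub>R b = ((\<alpha> + \<beta>) * (M / 2)) *\<^sub>R m + ((\<alpha> - \<beta>) * (E / 2)) *\<^sub>R e"
        unfolding ab by (simp add: algebra_simps add_divide_distrib diff_divide_distrib)
      moreover have "(\<alpha> + \<beta>) * (M / 2) = m \<bullet> y" "(\<alpha> - \<beta>) * (E / 2) = e \<bullet> y"
        using ME by (simp_all add: \<alpha>_def \<beta>_def)
      ultimately show "y \<in> ?C" using fr.frame_expansion[of y] ny by (simp add: add.commute)
    qed
  qed (use convex closed below ME conic_conic_hull in \<open>auto simp: U_def\<close>)
  then show ?thesis using that by blast
qed

section \<open>The illumination body near the facet\<close>

text \<open>By this symmetry, estimates for an apex displaced by \<open>s\<close> also hold with the same tent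
  for the apex displaced by \<open>- s\<close>.\<close>

lemma (in facet_cone) facet_cone_mirror: "facet_cone (- e) m n C U"
  using unit orth convex conic closed U_pos below facet by unfold_locales auto

theorem theorem4p4:
  fixes K :: "(real ^ 3) set"
  assumes "convex_body K"
    and "\<exists>A. geodesic_segment A \<and> A \<subseteq> sphere_boundary K"
  shows "\<exists>\<delta>\<^sub>0 > 0. \<forall>\<delta>. 0 < \<delta> \<and> \<delta> < \<delta>\<^sub>0 \<longrightarrow> \<not> geodesically_convex (illumination_body \<delta> K)"
proof -
  let ?C = "conic hull K"
  obtain w where K: "compact K" "geodesically_convex K" and w: "\<And>x. x \<in> K \<Longrightarrow> 0 < w \<bullet> x" and "norm w = 1"
    using assms(1) unfolding convex_body_def by (metis mem_sphere_0)
  have C: "convex ?C" using K(2) w by (rule convex_conic_hull_geodesic)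
  obtain A where "geodesic_segment A" "A \<subseteq> sphere_boundary K" using assms(2) by blast
  from supporting_plane_of_boundary_segment[OF K C this] obtain u v n h where
    frame: "orthonormal_frame u v n" "\<And>y. y \<in> ?C \<Longrightarrow> n \<bullet> y \<le> 0"
    "u \<in> K" "great_circle u v h \<in> K" "0 < h" "h < pi" by blast
  have "K \<noteq> {}" using frame by blast
  obtain e m U where "facet_cone e m n ?C U"
    using facet_cone_of_supporting_plane[OF K w frame] by blast
  then interpret P: facet_cone e m n ?C U .
  interpret N: facet_cone "- e" m n ?C U by (rule P.facet_cone_mirror)
  have mirror: "N.apex s \<tau> = P.apex (- s) \<tau>" for s \<tau> by (simp add: P.apex_def N.apex_def)
  define s where "s = U / 2"
  have s: "0 < s" "s < U" using P.U_pos by (simp_all add: s_def)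
  \<comment> \<open>Any value strictly between the two volumes; it absorbs the errors of smaller order on both sides.\<close>
  define c where "c = (measure lebesgue (tent U s) + measure lebesgue (tent U 0)) / 2"
  have c: "measure lebesgue (tent U s) < c" "c < measure lebesgue (tent U 0)"
    using tent_volume_centred_greater[OF s] by (simp_all add: c_def)
  have "0 < c" using c(1) by (meson measure_nonneg order_le_less_trans)
  have pos: "\<exists>\<tau>\<^sub>0>0. \<forall>\<tau>. 0 < \<tau> \<longrightarrow> \<tau> < \<tau>\<^sub>0 \<longrightarrow> 0 < w \<bullet> P.apex r \<tau>" if "\<bar>r\<bar> \<le> U" for r
  proof -
    have "n \<bullet> P.apex r 0 = 0" "P.apex r 0 \<in> ?C" using that P.facet[of "P.apex r 0"] P.apex_inner by simp_all
    then obtain t k where k: "P.apex r 0 = t *\<^sub>R k" "0 \<le> t" "k \<in> K" by (auto simp: conic_hull_explicit)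
    have "t \<noteq> 0" using k P.apex_inner(2)[of r 0] by auto
    then have pos0: "0 < w \<bullet> P.apex r 0" using k w by simp
    have "0 < w \<bullet> P.apex r \<tau>" if "0 < \<tau>" "\<tau> < w \<bullet> P.apex r 0" for \<tau>
    proof -
      have "\<bar>w \<bullet> n\<bar> \<le> 1" using Cauchy_Schwarz_ineq2[of w n] \<open>norm w = 1\<close> P.unit by simp
      then have "\<tau> * (- 1) \<le> \<tau> * (w \<bullet> n)" using that by (intro mult_left_mono) auto
      then show ?thesis using that by (simp add: P.apex_def inner_add_right)
    qed
    then show ?thesis using pos0 by blast
  qed
  have abs_s: "\<bar>s\<bar> < U" "\<bar>s\<bar> \<le> U" "\<bar>- s\<bar> \<le> U" "\<bar>0\<bar> \<le> U" using s by auto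
  obtain t1 where t1: "0 < t1" "\<And>\<tau>. 0 < \<tau> \<Longrightarrow> \<tau> < t1 \<Longrightarrow> 0 < w \<bullet> P.apex s \<tau>" using pos[OF abs_s(2)] by blast
  obtain t2 where t2: "0 < t2" "\<And>\<tau>. 0 < \<tau> \<Longrightarrow> \<tau> < t2 \<Longrightarrow> 0 < w \<bullet> P.apex (- s) \<tau>" using pos[OF abs_s(3)] by blast
  obtain t3 where t3: "0 < t3" "\<And>\<tau>. 0 < \<tau> \<Longrightarrow> \<tau> < t3 \<Longrightarrow> 0 < w \<bullet> P.apex 0 \<tau>" using pos[OF abs_s(4)] by blast
  obtain t4 where t4: "0 < t4" "\<And>\<tau>. 0 < \<tau> \<Longrightarrow> \<tau> < t4 \<Longrightarrow> measure lebesgue (gain ?C (P.apex s \<tau>)) \<le> \<tau> * c"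
    using P.gain_volume_upper[OF abs_s(1) c(1)] by blast
  obtain t5 where t5: "0 < t5" "\<And>\<tau>. 0 < \<tau> \<Longrightarrow> \<tau> < t5 \<Longrightarrow> measure lebesgue (gain ?C (P.apex (- s) \<tau>)) \<le> \<tau> * c"
    using N.gain_volume_upper[OF abs_s(1) c(1)] unfolding mirror by blast
  obtain t6 where t6: "0 < t6" "\<And>\<tau>. 0 < \<tau> \<Longrightarrow> \<tau> < t6 \<Longrightarrow> \<tau> * c < measure lebesgue (gain ?C (P.apex 0 \<tau>))"
    using P.gain_volume_lower[OF less_imp_le[OF \<open>0 < c\<close>] c(2)] by blast
  define \<tau>\<^sub>0 where "\<tau>\<^sub>0 = Min {t1, t2, t3, t4, t5, t6}"
  have "0 < \<tau>\<^sub>0" using t1 t2 t3 t4 t5 t6 by (simp add: \<tau>\<^sub>0_def)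
  show ?thesis
  proof (intro exI[of _ "3 * c * \<tau>\<^sub>0"] conjI allI impI notI)
    show "0 < 3 * c * \<tau>\<^sub>0" using \<open>0 < c\<close> \<open>0 < \<tau>\<^sub>0\<close> by simp
    fix \<delta> assume \<delta>: "0 < \<delta> \<and> \<delta> < 3 * c * \<tau>\<^sub>0" and convex: "geodesically_convex (illumination_body \<delta> K)"
    \<comment> \<open>The height for which the lateral added area is at most \<open>\<delta>\<close> and the central one exceeds it.\<close>
    define \<tau> where "\<tau> = \<delta> / (3 * c)"
    have \<tau>: "0 < \<tau>" "\<tau> < \<tau>\<^sub>0" "\<delta> = 3 * (\<tau> * c)" using \<delta> \<open>0 < c\<close> by (simp_all add: \<tau>_def field_simps)
    have less: "\<tau> < t1" "\<tau> < t2" "\<tau> < t3" "\<tau> < t4" "\<tau> < t5" "\<tau> < t6" using \<tau>(2) by (simp_all add: \<tau>\<^sub>0_def)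
    define x where "x r = P.apex r \<tau>" for r
    have wx: "0 < w \<bullet> x s" "0 < w \<bullet> x (- s)" "0 < w \<bullet> x 0" using t1 t2 t3 less \<tau>(1) by (simp_all add: x_def)
    have mem: "x r /\<^sub>R norm (x r) \<in> illumination_body \<delta> K \<longleftrightarrow> measure lebesgue (gain ?C (x r)) \<le> \<tau> * c"
      if "0 < w \<bullet> x r" for r
    proof -
      have "x r \<noteq> 0" using that by auto
      moreover have "- x r \<notin> ?C"
      proof
        assume "- x r \<in> ?C"
        then obtain t k where k: "- x r = t *\<^sub>R k" "0 \<le> t" "k \<in> K" by (auto simp: conic_hull_explicit)
        then have "- (w \<bullet> x r) = t * (w \<bullet> k)" by (metis inner_minus_right inner_scaleR_right)
        moreover have "0 \<le> t * (w \<bullet> k)" using k w by (simp add: less_imp_le)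
        ultimately show False using that by simp
      qed
      ultimately show ?thesis
        using spherical_area_gain[OF K(2) \<open>K \<noteq> {}\<close> C] \<tau>(3) by (simp add: illumination_body_def)
    qed
    define p where "p = x s /\<^sub>R norm (x s)"
    define q where "q = x (- s) /\<^sub>R norm (x (- s))"
    have p: "p \<in> illumination_body \<delta> K" and q: "q \<in> illumination_body \<delta> K"
      using mem wx t4(2)[OF \<tau>(1)] t5(2)[OF \<tau>(1)] less by (simp_all add: p_def q_def x_def)
    have nz: "x s \<noteq> 0" "x (- s) \<noteq> 0" "x 0 \<noteq> 0" using wx by (metis inner_zero_right less_irrefl)+
    have "0 < w \<bullet> p" "0 < w \<bullet> q"
      unfolding p_def q_def inner_scaleR_right using wx nz by (metis mult_pos_pos positive_imp_inverse_positive zero_less_norm_iff)+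
    then have "p \<noteq> - q" by (metis inner_minus_right neg_0_less_iff_less less_asym)
    define \<alpha> where "\<alpha> = norm (x s) / (2 * norm (x 0))"
    define \<beta> where "\<beta> = norm (x (- s)) / (2 * norm (x 0))"
    have sum: "x s + x (- s) = 2 *\<^sub>R x 0" unfolding scaleR_2 by (simp add: x_def P.apex_def)
    have "\<alpha> *\<^sub>R p = (1 / (2 * norm (x 0))) *\<^sub>R x s" "\<beta> *\<^sub>R q = (1 / (2 * norm (x 0))) *\<^sub>R x (- s)"
      unfolding \<alpha>_def \<beta>_def p_def q_def scaleR_scaleR using nz by (simp_all add: divide_simps)
    then have "\<alpha> *\<^sub>R p + \<beta> *\<^sub>R q = (1 / (2 * norm (x 0))) *\<^sub>R (x s + x (- s))"
      by (simp only: scaleR_right_distrib)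
    also have "\<dots> = x 0 /\<^sub>R norm (x 0)" unfolding sum scaleR_scaleR by (simp add: inverse_eq_divide)
    finally have mid: "\<alpha> *\<^sub>R p + \<beta> *\<^sub>R q = x 0 /\<^sub>R norm (x 0)" .
    moreover have "0 \<le> \<alpha>" "0 \<le> \<beta>" by (simp_all add: \<alpha>_def \<beta>_def)
    moreover have "norm (x 0 /\<^sub>R norm (x 0)) = 1" using nz by simp
    ultimately have "x 0 /\<^sub>R norm (x 0) \<in> illumination_body \<delta> K"
      using geodesically_convex_combination[OF convex p q \<open>p \<noteq> - q\<close>, of \<alpha> \<beta>]
      unfolding mid by blast
    then have "measure lebesgue (gain ?C (x 0)) \<le> \<tau> * c" by (simp only: mem[OF wx(3)])
    moreover have "\<tau> * c < measure lebesgue (gain ?C (x 0))" using t6(2)[OF \<tau>(1)] less by (simp add: x_def)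
    ultimately show False by simp
  qed
qed

end
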